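(* Let $d\ge1$, $0<c_j<1$ for $j\in D=\{1,\dots,d\}$, let $\mathbf{X}_0$ and $\mathbf{Y}_n=(Y_{n,1},\dots,Y_{n,d})$, $n\ge1$, be independent random vectors in $\mathbb{R}^d$ with $\mathbf{Y}_n\sim G$ for all $n$, and let $X_{n,j}=\max(c_jX_{n-1,j},\,Y_{n,j})$ for $n\ge1$, $j\in D$. Suppose $\{\mathbf{X}_n=(X_{n,1},\dots,X_{n,d})\}$ is stationary with common distribution function $F$. If $F\in\mathcal{D}(H)$, where $H$ has margins $H_j\in\{\Lambda,\Psi_{\alpha_j},\Phi_{\alpha_j}\}$ for some $\alpha_j>0$, then $G\in\mathcal{D}(V)$ for a distribution function $V$ with margins $V_j=H_j^{\theta_j}$, $j\in D$, where $$\theta_j=\begin{cases}1, & \text{if } H_j\in\{\Lambda,\Psi_{\alpha_j}\},\\ 1-c_j^{\alpha_j}, & \text{if } H_j=\Phi_{\alpha_j},\end{cases}$$ and with copula $$C_V(u_1,\dots,u_d)=\frac{C_H\big(u_1^{1/\theta_1},\dots,u_d^{1/\theta_d}\big)}{C_H\big(u_1^{1/\theta_1-1},\dots,u_d^{1/\theta_d-1}\big)},\qquad (u_1,\dots,u_d)\in(0,1]^d.$$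
   Context: $\Lambda(x)=\exp(-e^{-x})$; $\Psi_\alpha(x)=e^{-(-x)^\alpha}$ for $x\le0$ and $1$ for $x>0$; $\Phi_\alpha(x)=e^{-x^{-\alpha}}$ for $x>0$ and $0$ for $x\le0$. $F\in\mathcal{D}(H)$ (max-domain of attraction) means that there are constants $a_{n,j}>0$, $b_{n,j}$ with $F^n(a_{n,1}x_1+b_{n,1},\dots,a_{n,d}x_d+b_{n,d})\to H(x_1,\dots,x_d)$ as $n\to\infty$ for all $\mathbf{x}$; similarly for $G\in\mathcal{D}(V)$. For a distribution function $H$ with continuous margins $H_j$, $C_H(u_1,\dots,u_d)=H(H_1^{-1}(u_1),\dots,H_d^{-1}(u_d))$ denotes its copula. *)

theory Defs
  imports "HOL-Probability.Probability"
begin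

definition gumbel :: "real \<Rightarrow> real" where
  "gumbel x = exp (- exp (- x))"

definition weibull :: "real \<Rightarrow> real \<Rightarrow> real" where
  "weibull \<alpha> x = (if x \<le> 0 then exp (- ((- x) powr \<alpha>)) else 1)"

definition frechet :: "real \<Rightarrow> real \<Rightarrow> real" where
  "frechet \<alpha> x = (if x > 0 then exp (- (x powr (- \<alpha>))) else 0)"

text \<open>
  A distribution function on \<open>real ^ 'd\<close> is represented by the Borel probability measure it
  determines. The arguments of the distribution function range over the extended reals, because
  the copula evaluates it at quantiles, and the quantile at level 1 may be \<open>\<infinity>\<close>.
\<close>

definition joint_cdf :: "(real ^ 'd) measure \<Rightarrow> ('d \<Rightarrow> ereal) \<Rightarrow> real" where
  "joint_cdf H x = measure H {y. \<forall>j. ereal (y $ j) \<le> x j}"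

definition margin :: "(real ^ 'd) measure \<Rightarrow> 'd \<Rightarrow> real measure" where
  "margin H j = distr H borel (\<lambda>y. y $ j)"

text \<open>The infimum is taken in the extended reals, so it is \<open>\<infinity>\<close> if the level is not attained.\<close>

definition quantile :: "real measure \<Rightarrow> real \<Rightarrow> ereal" where
  "quantile \<mu> u = (INF x \<in> {x. u \<le> cdf \<mu> x}. ereal x)"

definition copula :: "(real ^ 'd) measure \<Rightarrow> ('d \<Rightarrow> real) \<Rightarrow> real" where
  "copula H u = joint_cdf H (\<lambda>j. quantile (margin H j) (u j))"

definition max_domain_of_attraction :: "(real ^ 'd) measure \<Rightarrow> (real ^ 'd) measure \<Rightarrow> bool" where
  "max_domain_of_attraction F H \<longleftrightarrow>
     (\<exists>a b :: nat \<Rightarrow> 'd \<Rightarrow> real. (\<forall>n j. a n j > 0) \<and>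
        (\<forall>x :: 'd \<Rightarrow> real.
           (\<lambda>n. joint_cdf F (\<lambda>j. ereal (a n j * x j + b n j)) ^ n)
             \<longlonglongrightarrow> joint_cdf H (\<lambda>j. ereal (x j))))"

text \<open>Strict stationarity: the law of the whole sequence is invariant under time shifts.\<close>

definition stationary :: "'a measure \<Rightarrow> (nat \<Rightarrow> 'a \<Rightarrow> 'b :: topological_space) \<Rightarrow> bool" where
  "stationary M X \<longleftrightarrow>
     (\<forall>k. distr M (PiM UNIV (\<lambda>_. borel)) (\<lambda>\<omega> n. X (n + k) \<omega>) =
          distr M (PiM UNIV (\<lambda>_. borel)) (\<lambda>\<omega> n. X n \<omega>))"

end

theory Submission
  imports Defs
begin

text \<open>
  For a point \<open>x\<close> write \<open>x / c\<close> for the point with coordinates \<open>x j / c j\<close>. By independence, one step of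
  the recursion gives \<open>F x = F (x / c) * G x\<close>. Let \<open>a n\<close>, \<open>b n\<close> be the normalising constants of \<open>F\<close>. Raising to the
  power \<open>n\<close> and normalising turns this into \<open>P n x = P n (y n x) * Q n x\<close>, where \<open>P n\<close> and \<open>Q n\<close> are the
  laws of the normalised maximum of \<open>n\<close> independent vectors with laws \<open>F\<close> and \<open>G\<close>, and the shrunk argument is
  \<open>y n x j = x j / c j + (1 / c j - 1) * b n j / a n j\<close>. As \<open>P n\<close> converges to \<open>H\<close>, everything depends on
  the limit of \<open>b n j / a n j\<close>:

  \<^item> If \<open>H_j\<close> is a Gumbel or Weibull distribution function, the limit is \<open>\<infinity>\<close>. The inequality
    \<open>F_j x \<le> F_j (x / c j)\<close> forces \<open>F_j\<close> to vanish on negative numbers, while \<open>H_j\<close> vanishes nowhere, so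
    \<open>a n j * x + b n j\<close> is eventually nonnegative for every real \<open>x\<close>
    (\<open>location_dominates_scale\<close>).

  \<^item> If \<open>H_j\<close> is a Frechet distribution function, the limit is 0. Comparing the normalisations for \<open>n\<close> and
    \<open>n div 2\<close> gives \<open>b n / a n = A\<^sub>n * b (n div 2) / a (n div 2) + o(1)\<close> with \<open>A\<^sub>n\<close> tending to
    \<open>2 powr (- 1 / \<alpha>) < 1\<close>, and such a recursion contracts to 0
    (\<open>frechet_location_negligible\<close>).

  Hence \<open>y n x\<close> converges to the point \<open>e x\<close> with coordinates \<open>x j / c j\<close> in the Frechet case and \<open>\<infinity>\<close>
  otherwise, and \<open>Q n x\<close> converges to \<open>H x / H (e x)\<close> where the margins of \<open>H\<close> are positive, and to 0
  elsewhere. All distribution functions are evaluated at points that may have coordinates \<open>\<infinity>\<close>,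
  so the margins are included.

  It remains to see that the pointwise limit is the distribution function of a probability measure
  \<open>V\<close> (\<open>limit_of_vector_distributions\<close>). Its margins \<open>H_j powr \<theta> j\<close> are continuous and proper.
  Compactness is taken from Helly's theorem on the line: a space-filling curve with a Borel right inverse carries
  the laws \<open>Q n\<close> to the unit interval and a subsequential limit back to the space of vectors.

  The copula formula then reads off values: a joint distribution function depends on its argument only
  through the values of the margins there (\<open>joint_cdf_lipschitz\<close>). At the point where the margins of
  \<open>V\<close> equal \<open>u j\<close>, those of \<open>H\<close> equal \<open>u j powr (1 / \<theta> j)\<close>, and at the image of this point
  under \<open>e\<close> they equal \<open>u j powr (1 / \<theta> j - 1)\<close>.
\<close>

section \<open>A space-filling curve with a Borel right inverse\<close>

text \<open>
  A continuous function of period 2 that is 0 on \<open>[0, 1/3]\<close> and 1 on \<open>[2/3, 1]\<close>. Hence at the points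
  \<open>3 ^ m * t\<close> it reads off ternary digits of \<open>t\<close> as long as these are 0 or 2.
\<close>

definition wave :: "real \<Rightarrow> real" where
  "wave s = max 0 (min 1 (1 / 2 - cos (pi * s)))"

text \<open>
  Schoenberg's space-filling curve. The binary digits of all coordinates are stored in a single ternary
  expansion; \<open>to_nat\<close> assigns a place to the digit \<open>k\<close> of the coordinate \<open>j\<close>.
\<close>

definition schoenberg_curve :: "real \<Rightarrow> real ^ 'd" where
  "schoenberg_curve t =
     (\<chi> j. \<Sum>k. wave (3 ^ to_nat (k :: nat, j) * t) / 2 ^ Suc k)"

lemma wave_bounds: "0 \<le> wave s" "wave s \<le> 1"
  by (auto simp: wave_def)

lemma continuous_on_wave: "continuous_on A wave"
  unfolding wave_def by (intro continuous_intros)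

lemma half_powers_sums: "(\<lambda>k. 1 / 2 ^ Suc k :: real) sums 1"
  using power_half_series by (simp add: power_one_over)

lemma wave_series_bound: "norm (wave s / 2 ^ Suc k) \<le> 1 / 2 ^ Suc k"
  using wave_bounds[of s] by (simp add: divide_right_mono)

lemma summable_wave_series: "summable (\<lambda>k. wave (g k) / 2 ^ Suc k)"
  by (rule summable_comparison_test'[OF sums_summable[OF half_powers_sums], of 0])
    (rule wave_series_bound)

lemma continuous_on_schoenberg_curve:
  "continuous_on UNIV (schoenberg_curve :: real \<Rightarrow> real ^ 'd)"
proof -
  have "continuous_on UNIV (\<lambda>t. \<Sum>k. wave (3 ^ to_nat (k :: nat, j :: 'd) * t) / 2 ^ Suc k)" for j
  proof (rule uniform_limit_theorem[OF _ Weierstrass_m_test])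
    show "\<forall>\<^sub>F n in sequentially.
        continuous_on UNIV (\<lambda>t. \<Sum>k<n. wave (3 ^ to_nat (k, j) * t) / 2 ^ Suc k)"
      by (intro always_eventually allI continuous_intros
          continuous_on_compose2[OF continuous_on_wave[of UNIV]]) auto
    show "summable (\<lambda>k. 1 / 2 ^ Suc k :: real)"
      by (rule sums_summable[OF half_powers_sums])
  qed (use wave_series_bound in auto)
  then show ?thesis
    unfolding schoenberg_curve_def by (intro continuous_on_vec_lambda)
qed

lemma schoenberg_curve_bounds: "0 \<le> schoenberg_curve t $ j" "schoenberg_curve t $ j \<le> 1"
proof -
  show "0 \<le> schoenberg_curve t $ j"
    unfolding schoenberg_curve_def vec_lambda_beta
    by (intro suminf_nonneg summable_wave_series) (simp add: wave_bounds)
  have "(\<Sum>k. wave (3 ^ to_nat (k, j) * t) / 2 ^ Suc k) \<le> (\<Sum>k. 1 / 2 ^ Suc k)"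
    by (intro suminf_le summable_wave_series sums_summable[OF half_powers_sums]
        divide_right_mono wave_bounds) simp
  then show "schoenberg_curve t $ j \<le> 1"
    using sums_unique[OF half_powers_sums] by (simp add: schoenberg_curve_def)
qed

text \<open>
  The number \<open>(2 * d + t) / 3\<close> lies in \<open>[0, 1/3]\<close> or in \<open>[2/3, 1]\<close>, according to the digit \<open>d\<close>.
\<close>

lemma wave_digit:
  assumes "d \<in> {0, 1 :: nat}" "0 \<le> t" "t \<le> 1"
  shows "wave (2 * real_of_int i + (2 * real d + t) / 3) = real d"
proof -
  define r where "r = (2 * real d + t) / 3"
  have "pi * (2 * real_of_int i + r) = pi * r + of_int i * (2 * pi)"
    by (simp add: algebra_simps)
  then have *: "cos (pi * (2 * real_of_int i + r)) = cos (pi * r)"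
    using cos_int_2pin[of i] sin_int_2pin[of i] by (simp add: cos_add mult.commute)
  have **: "1 / 2 \<le> cos (pi * r)" if "d = 0"
  proof -
    have "cos (pi / 3) \<le> cos (pi * r)"
      using that assms by (intro cos_monotone_0_pi_le) (auto simp: r_def)
    then show ?thesis by (simp add: cos_60)
  qed
  have "cos (pi * r) \<le> - 1 / 2" if "d = 1"
  proof -
    have "cos (pi * r) \<le> cos (2 * (pi / 3))"
      using that assms by (intro cos_monotone_0_pi_le) (auto simp: r_def field_simps)
    then show ?thesis by (simp add: cos_120 cos_double_cos cos_60 power2_eq_square)
  qed
  with * ** assms show ?thesis
    unfolding r_def[symmetric] by (auto simp: wave_def)
qed

text \<open>
  The point is \<open>t = (\<Sum>i. 2 * d i / 3 ^ (i + 1))\<close>: up to an even integer, \<open>3 ^ m * t\<close> is the number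
  whose expansion has the digits of \<open>t\<close> from place \<open>m\<close> on.
\<close>

lemma wave_reads_digits:
  fixes d :: "nat \<Rightarrow> nat"
  assumes d: "\<And>m. d m \<in> {0, 1}"
  obtains t where "t \<in> {0..1}" "\<And>m. wave (3 ^ m * t) = real (d m)"
proof -
  define T where "T m = (\<Sum>i. 2 * real (d (m + i)) / 3 ^ Suc i)" for m
  have geo: "(\<lambda>i. 2 / 3 ^ Suc i :: real) sums 1"
    using sums_mult[OF geometric_sums[of "1 / 3 :: real"], of "2 / 3"]
    by (simp add: power_one_over)
  have bd: "norm (2 * real (d k) / 3 ^ Suc i) \<le> 2 / 3 ^ Suc i" for k i
    using d[of k] by auto
  have sm: "summable (\<lambda>i. 2 * real (d (m + i)) / 3 ^ Suc i)" for m
    by (rule summable_comparison_test'[OF sums_summable[OF geo], of 0]) (rule bd)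
  have T: "0 \<le> T m" "T m \<le> 1" for m
  proof -
    show "0 \<le> T m" unfolding T_def by (intro suminf_nonneg sm) auto
    have "T m \<le> (\<Sum>i. 2 / 3 ^ Suc i)"
      unfolding T_def using bd by (intro suminf_le sm sums_summable[OF geo]) (auto simp: abs_le_iff)
    then show "T m \<le> 1" using sums_unique[OF geo] by simp
  qed
  have step: "T m = (2 * real (d m) + T (Suc m)) / 3" for m
  proof -
    have "T m = (\<Sum>i. 2 * real (d (m + Suc i)) / 3 ^ Suc (Suc i)) + 2 * real (d m) / 3"
      unfolding T_def by (subst suminf_split_head[OF sm]) simp
    also have "(\<Sum>i. 2 * real (d (m + Suc i)) / 3 ^ Suc (Suc i)) = T (Suc m) / 3"
      unfolding T_def by (subst suminf_divide[OF sm, symmetric]) simp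
    finally show ?thesis by (simp add: field_simps)
  qed
  have "\<exists>i :: int. 3 ^ m * T 0 = 2 * of_int i + T m" for m
  proof (induction m)
    case 0
    show ?case by (intro exI[of _ 0]) simp
  next
    case (Suc m)
    then obtain i :: int where "3 ^ m * T 0 = 2 * of_int i + T m" by blast
    then have "3 ^ Suc m * T 0 = 3 * (2 * of_int i + T m)" by simp
    also have "\<dots> = 2 * of_int (3 * i + int (d m)) + T (Suc m)"
      by (subst step) simp
    finally have "3 ^ Suc m * T 0 = 2 * of_int (3 * i + int (d m)) + T (Suc m)" .
    then show ?case by blast
  qed
  then have "wave (3 ^ m * T 0) = real (d m)" for m
    using wave_digit[OF d T, of _ m "Suc m"] step[of m] by metis
  with that[of "T 0"] T show ?thesis by auto
qed

lemma binary_expansion: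
  fixes y :: real
  assumes "0 \<le> y" "y < 1"
  shows "(\<lambda>k. real (nat (\<lfloor>2 ^ Suc k * y\<rfloor> mod 2)) / 2 ^ Suc k) sums y"
proof -
  have part: "(\<Sum>k<n. real (nat (\<lfloor>2 ^ Suc k * y\<rfloor> mod 2)) / 2 ^ Suc k) = \<lfloor>2 ^ n * y\<rfloor> / 2 ^ n" for n
  proof (induction n)
    case 0
    then show ?case using assms by (simp add: floor_eq_iff)
  next
    case (Suc n)
    have "\<lfloor>2 ^ Suc n * y\<rfloor> div 2 = \<lfloor>2 ^ n * y\<rfloor>"
      using floor_divide_of_nat_eq[where 'a = real] floor_divide_real_eq_div[of 2 "2 ^ Suc n * y"] by simp
    then have "real_of_int \<lfloor>2 ^ Suc n * y\<rfloor> = 2 * of_int \<lfloor>2 ^ n * y\<rfloor> + of_int (\<lfloor>2 ^ Suc n * y\<rfloor> mod 2)"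
      by (metis mult_div_mod_eq of_int_add of_int_mult of_int_numeral)
    with Suc show ?case by (simp add: field_simps)
  qed
  have "(\<lambda>n. \<lfloor>2 ^ n * y\<rfloor> / 2 ^ n) \<longlonglongrightarrow> y"
  proof (rule tendsto_sandwich[of "\<lambda>n. y - (1 / 2) ^ n" _ _ "\<lambda>n. y"])
    show "\<forall>\<^sub>F n in sequentially. y - (1 / 2) ^ n \<le> \<lfloor>2 ^ n * y\<rfloor> / 2 ^ n"
    proof (intro always_eventually allI)
      fix n
      have "(2 ^ n * y - 1) / 2 ^ n \<le> \<lfloor>2 ^ n * y\<rfloor> / 2 ^ n"
        by (intro divide_right_mono) (linarith, simp)
      then show "y - (1 / 2) ^ n \<le> \<lfloor>2 ^ n * y\<rfloor> / 2 ^ n"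
        by (simp add: diff_divide_distrib power_one_over)
    qed
    show "\<forall>\<^sub>F n in sequentially. \<lfloor>2 ^ n * y\<rfloor> / 2 ^ n \<le> y"
      by (intro always_eventually allI) (simp add: pos_divide_le_eq mult.commute)
    show "(\<lambda>n. y - (1 / 2) ^ n) \<longlonglongrightarrow> y"
      using tendsto_diff[OF tendsto_const LIMSEQ_realpow_zero[of "1 / 2"]] by simp
  qed auto
  then show ?thesis unfolding sums_def part .
qed

text \<open>
  The point 1 is left out because the digits given by \<open>\<lfloor>2 ^ Suc k * y\<rfloor> mod 2\<close> vanish there. It is
  enough for the curve to pass through the interior of the cube.
\<close>

lemma schoenberg_curve_onto:
  fixes y :: "real ^ 'd"
  assumes "\<And>j. 0 \<le> y $ j" "\<And>j. y $ j < 1"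
  shows "y \<in> schoenberg_curve ` {0..1}"
proof -
  define d where "d m = (case from_nat m of (k :: nat, j :: 'd) \<Rightarrow> nat (\<lfloor>2 ^ Suc k * y $ j\<rfloor> mod 2))" for m
  have "d m \<in> {0, 1}" for m
  proof -
    have "x mod 2 \<in> {0, 1}" for x :: int by auto
    then show ?thesis by (auto simp: d_def split: prod.split)
  qed
  then obtain t where t: "t \<in> {0..1}" "\<And>m. wave (3 ^ m * t) = real (d m)"
    using wave_reads_digits by blast
  have "schoenberg_curve t $ j = y $ j" for j
    using sums_unique[OF binary_expansion[OF assms, of j]]
    by (simp add: schoenberg_curve_def t d_def)
  then have "schoenberg_curve t = y" by (simp add: vec_eq_iff)
  with t show ?thesis by blast
qed

text \<open>
  The least parameter of each point is a Borel choice: the points whose least parameter is at most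
  \<open>s\<close> form the image of \<open>[0, s]\<close>, which is compact. Outside the image of the curve the
  value 0 is chosen.
\<close>

lemma continuous_curve_borel_section:
  fixes f :: "real \<Rightarrow> 'b :: t2_space"
  assumes cont: "continuous_on {0..1} f"
  obtains g where "g \<in> borel_measurable borel" "\<And>y. g y \<in> {0..1}"
    "\<And>y. y \<in> f ` {0..1} \<Longrightarrow> f (g y) = y"
proof -
  define P where "P y = {t \<in> {0..1}. f t = y}" for y
  have compactP: "compact (P y)" for y
  proof -
    have "closed (P y)"
      unfolding P_def using continuous_closed_preimage_constant[OF cont, of y] by simp
    then have "compact ({0..1} \<inter> P y)" by (intro compact_Int_closed) auto
    moreover have "{0..1} \<inter> P y = P y" by (auto simp: P_def)
    ultimately show ?thesis by simp
  qed
  define g where "g y = (if y \<in> f ` {0..1} then Inf (P y) else 0)" for y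
  have gP: "g y \<in> P y" and least: "\<And>t. t \<in> P y \<Longrightarrow> g y \<le> t" if "y \<in> f ` {0..1}" for y
  proof -
    have "P y \<noteq> {}" using that by (auto simp: P_def)
    then obtain s where s: "s \<in> P y" "\<And>t. t \<in> P y \<Longrightarrow> s \<le> t"
      using compact_attains_inf[OF compactP] by metis
    then have "Inf (P y) = s" by (intro cInf_eq_minimum)
    with s that show "g y \<in> P y" "\<And>t. t \<in> P y \<Longrightarrow> g y \<le> t" by (auto simp: g_def)
  qed
  have cl: "closed (f ` {0..s})" if "s \<le> 1" for s
    using that by (intro compact_imp_closed compact_continuous_image continuous_on_subset[OF cont]) auto
  have "{y. g y \<le> s} \<in> sets borel" for s
  proof -
    have "{y. g y \<le> s} = (if s < 0 then {} else f ` {0..min s 1} \<union> - f ` {0..1})"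
    proof (rule set_eqI)
      fix y
      show "y \<in> {y. g y \<le> s} \<longleftrightarrow> y \<in> (if s < 0 then {} else f ` {0..min s 1} \<union> - f ` {0..1})"
      proof (cases "y \<in> f ` {0..1}")
        case True
        then have "g y \<in> {0..1}" "f (g y) = y" using gP by (auto simp: P_def)
        moreover have "g y \<le> s" if "t \<in> {0..min s 1}" "y = f t" for t
          using least[OF True, of t] that by (auto simp: P_def)
        ultimately show ?thesis using True by (auto simp: image_iff intro!: bexI[of _ "g y"])
      qed (auto simp: g_def)
    qed
    also have "\<dots> \<in> sets borel"
      using cl by (auto intro!: sets.Un sets.Diff[of UNIV, simplified Compl_eq_Diff_UNIV[symmetric]] borel_closed)
    finally show ?thesis .
  qed
  then have "g \<in> borel_measurable borel"
    by (simp add: borel_measurable_iff_le)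
  moreover have "g y \<in> {0..1}" for y
    using gP[of y] by (cases "y \<in> f ` {0..1}") (auto simp: P_def g_def)
  moreover have "f (g y) = y" if "y \<in> f ` {0..1}" for y
    using gP[OF that] by (auto simp: P_def)
  ultimately show ?thesis using that by blast
qed

section \<open>Joint distribution functions and their margins\<close>

lemma borel_measurable_vec_lambda:
  fixes f :: "'a \<Rightarrow> 'd :: finite \<Rightarrow> real"
  assumes "\<And>j. (\<lambda>x. f x j) \<in> borel_measurable M"
  shows "(\<lambda>x. \<chi> j. f x j) \<in> borel_measurable M"
proof (subst borel_measurable_euclidean_space, intro ballI)
  fix i :: "real ^ 'd" assume "i \<in> Basis"
  then obtain j where "i = axis j 1" by (auto simp: Basis_vec_def)
  then show "(\<lambda>x. (\<chi> j. f x j) \<bullet> i) \<in> borel_measurable M"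
    using assms by (simp add: inner_axis)
qed

lemma borel_measurable_vec_nth' [measurable (raw)]:
  fixes f :: "'a \<Rightarrow> real ^ 'd"
  shows "f \<in> borel_measurable M \<Longrightarrow> (\<lambda>x. f x $ j) \<in> borel_measurable M"
  by (rule borel_measurable_continuous_on) (intro continuous_intros)

text \<open>
  The counterpart of \<open>real_distribution\<close> for random vectors.
\<close>

locale vector_distribution = prob_space \<mu> for \<mu> :: "(real ^ 'd) measure" +
  assumes sets_eq_borel [simp, measurable_cong]: "sets \<mu> = sets borel"

text \<open>
  The margin with extended real arguments, expressed by the joint distribution function so that
  statements about the latter specialise to margins.
\<close>

definition joint_margin :: "(real ^ 'd) measure \<Rightarrow> 'd \<Rightarrow> ereal \<Rightarrow> real" where
  "joint_margin \<mu> j x = joint_cdf \<mu> ((\<lambda>_. \<infinity>)(j := x))"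

lemma coordinate_halfspace_borel [measurable]: "{y :: real ^ 'd. ereal (y $ j) \<le> x} \<in> sets borel"
  by measurable

lemma orthant_borel [measurable]: "{y :: real ^ 'd. \<forall>j. ereal (y $ j) \<le> x j} \<in> sets borel"
  by measurable

context vector_distribution
begin

lemma space_eq_UNIV [simp]: "space \<mu> = UNIV"
  using sets_eq_imp_space_eq[OF sets_eq_borel] by simp

lemma joint_margin_eq: "joint_margin \<mu> j x = prob {y. ereal (y $ j) \<le> x}"
  unfolding joint_margin_def joint_cdf_def by (rule arg_cong[where f = prob]) auto

lemma cdf_margin: "cdf (margin \<mu> j) = (\<lambda>x. joint_margin \<mu> j (ereal x))"
proof
  fix x
  have "cdf (margin \<mu> j) x = prob ((\<lambda>y. y $ j) -` {..x} \<inter> space \<mu>)"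
    unfolding cdf_def margin_def by (subst measure_distr) auto
  also have "(\<lambda>y. y $ j) -` {..x} \<inter> space \<mu> = {y. ereal (y $ j) \<le> ereal x}" by auto
  finally show "cdf (margin \<mu> j) x = joint_margin \<mu> j (ereal x)" by (simp add: joint_margin_eq)
qed

lemma real_distribution_margin: "real_distribution (margin \<mu> j)"
  unfolding margin_def by (rule real_distribution_distr) simp

lemma joint_cdf_nonneg: "0 \<le> joint_cdf \<mu> x" and joint_cdf_le_1: "joint_cdf \<mu> x \<le> 1"
  by (simp_all add: joint_cdf_def)

lemma joint_cdf_mono: "(\<And>j. x j \<le> y j) \<Longrightarrow> joint_cdf \<mu> x \<le> joint_cdf \<mu> y"
  unfolding joint_cdf_def by (intro finite_measure_mono) (auto intro: order_trans)

lemma joint_margin_nonneg: "0 \<le> joint_margin \<mu> j x" and joint_margin_le_1: "joint_margin \<mu> j x \<le> 1"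
  by (simp_all add: joint_margin_def joint_cdf_nonneg joint_cdf_le_1)

lemma joint_margin_mono: "x \<le> y \<Longrightarrow> joint_margin \<mu> j x \<le> joint_margin \<mu> j y"
  unfolding joint_margin_def by (intro joint_cdf_mono) auto

lemma joint_margin_infinity [simp]: "joint_margin \<mu> j \<infinity> = 1"
  using prob_space by (simp add: joint_margin_eq)

text \<open>
  Two orthants differ only where some coordinate separates them. The resulting Lipschitz bound is the
  source of all continuity statements: it reduces them to the margins, one coordinate at a time.
\<close>

lemma joint_cdf_diff_le:
  "joint_cdf \<mu> x - joint_cdf \<mu> y \<le> (\<Sum>j\<in>UNIV. \<bar>joint_margin \<mu> j (x j) - joint_margin \<mu> j (y j)\<bar>)"
proof -
  let ?S = "\<lambda>x. {z :: real ^ 'd. \<forall>j. ereal (z $ j) \<le> x j}"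
  let ?C = "\<lambda>x j. {z :: real ^ 'd. ereal (z $ j) \<le> x j}"
  have "joint_cdf \<mu> x - joint_cdf \<mu> y \<le> prob (?S x - ?S y)"
  proof -
    have "prob (?S x) \<le> prob ((?S x - ?S y) \<union> ?S y)"
      by (intro finite_measure_mono) auto
    also have "\<dots> \<le> prob (?S x - ?S y) + prob (?S y)"
      by (intro measure_Un_le) auto
    finally show ?thesis by (simp add: joint_cdf_def)
  qed
  also have "\<dots> \<le> prob (\<Union>j. ?C x j - ?C y j)"
    by (intro finite_measure_mono) auto
  also have "\<dots> \<le> (\<Sum>j\<in>UNIV. prob (?C x j - ?C y j))"
    by (intro finite_measure_subadditive_finite) auto
  also have "\<dots> \<le> (\<Sum>j\<in>UNIV. \<bar>joint_margin \<mu> j (x j) - joint_margin \<mu> j (y j)\<bar>)"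
  proof (intro sum_mono)
    fix j
    show "prob (?C x j - ?C y j) \<le> \<bar>joint_margin \<mu> j (x j) - joint_margin \<mu> j (y j)\<bar>"
    proof (cases "x j \<le> y j")
      case True
      then have *: "?C x j - ?C y j = {}" by (auto intro: order_trans)
      show ?thesis unfolding * by simp
    next
      case False
      then have "prob (?C x j - ?C y j) = prob (?C x j) - prob (?C y j)"
        by (intro finite_measure_Diff) (auto intro: order_trans)
      then show ?thesis by (simp add: joint_margin_eq)
    qed
  qed
  finally show ?thesis .
qed

lemma joint_cdf_lipschitz:
  "\<bar>joint_cdf \<mu> x - joint_cdf \<mu> y\<bar> \<le> (\<Sum>j\<in>UNIV. \<bar>joint_margin \<mu> j (x j) - joint_margin \<mu> j (y j)\<bar>)"
  using joint_cdf_diff_le[of x y] joint_cdf_diff_le[of y x] by (simp add: abs_minus_commute)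

lemma joint_cdf_union_bound: "1 - joint_cdf \<mu> x \<le> (\<Sum>j\<in>UNIV. 1 - joint_margin \<mu> j (x j))"
proof -
  have "joint_cdf \<mu> (\<lambda>_. \<infinity>) = 1"
    using prob_space by (simp add: joint_cdf_def)
  then show ?thesis
    using joint_cdf_diff_le[of "\<lambda>_. \<infinity>" x] joint_margin_le_1 by (simp add: abs_of_nonneg)
qed

lemma joint_margin_at_top: "((\<lambda>x. joint_margin \<mu> j (ereal x)) \<longlongrightarrow> 1) at_top"
  using real_distribution.cdf_lim_at_top_prob[OF real_distribution_margin, of j]
  by (simp add: cdf_margin)

lemma joint_margin_at_bot: "((\<lambda>x. joint_margin \<mu> j (ereal x)) \<longlongrightarrow> 0) at_bot"
  using finite_borel_measure.cdf_lim_at_bot[OF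
      real_distribution.finite_borel_measure_M[OF real_distribution_margin], of j]
  by (simp add: cdf_margin)

lemma joint_cdf_diagonal_at_top: "((\<lambda>K. joint_cdf \<mu> (\<lambda>_. ereal K)) \<longlongrightarrow> 1) at_top"
proof (rule tendsto_sandwich[of "\<lambda>K. 1 - (\<Sum>j\<in>UNIV. 1 - joint_margin \<mu> j (ereal K))" _ _ "\<lambda>_. 1"])
  show "\<forall>\<^sub>F K in at_top. 1 - (\<Sum>j\<in>UNIV. 1 - joint_margin \<mu> j (ereal K)) \<le> joint_cdf \<mu> (\<lambda>_. ereal K)"
    using joint_cdf_union_bound[of "\<lambda>_. ereal _"] by (intro always_eventually allI) (simp add: algebra_simps)
  have "((\<lambda>K. 1 - (\<Sum>j\<in>UNIV. 1 - joint_margin \<mu> j (ereal K))) \<longlongrightarrow> 1 - (\<Sum>j\<in>(UNIV :: 'd set). 1 - 1)) at_top"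
    by (intro tendsto_intros joint_margin_at_top)
  then show "((\<lambda>K. 1 - (\<Sum>j\<in>UNIV. 1 - joint_margin \<mu> j (ereal K))) \<longlongrightarrow> 1) at_top" by simp
qed (auto simp: joint_cdf_le_1)

end

text \<open>
  Replacing infinite coordinates by a large \<open>K\<close> changes a distribution function by at most the mass
  outside the orthant of the points below \<open>(K, \<dots>, K)\<close>. In the limit this mass is that of \<open>H\<close>, so no
  mass of \<open>P n\<close> escapes.
\<close>

lemma joint_cdf_tendsto_extended:
  fixes P :: "nat \<Rightarrow> (real ^ 'd) measure"
  assumes P: "\<And>n. vector_distribution (P n)" and H: "vector_distribution H"
    and conv: "\<And>x :: 'd \<Rightarrow> real. (\<lambda>n. joint_cdf (P n) (\<lambda>j. ereal (x j))) \<longlonglongrightarrow> joint_cdf H (\<lambda>j. ereal (x j))"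
    and x: "\<And>j. x j \<noteq> -\<infinity>"
  shows "(\<lambda>n. joint_cdf (P n) x) \<longlonglongrightarrow> joint_cdf H x"
proof (rule LIMSEQ_I)
  fix e :: real assume "e > 0"
  then have "\<forall>\<^sub>F K in at_top. joint_cdf H (\<lambda>_. ereal K) > 1 - e / 3"
    by (intro order_tendstoD[OF vector_distribution.joint_cdf_diagonal_at_top[OF H]]) auto
  then have "\<exists>K. joint_cdf H (\<lambda>_. ereal K) > 1 - e / 3"
    by (rule eventually_happens'[rotated]) simp
  then obtain K where "joint_cdf H (\<lambda>_. ereal K) > 1 - e / 3" by blast
  then have K: "1 - joint_cdf H (\<lambda>_. ereal K) < e / 3" by linarith
  define z where "z j = (if x j = \<infinity> then K else real_of_ereal (x j))" for j
  have sq: "joint_cdf \<mu> (\<lambda>j. ereal (z j)) \<le> joint_cdf \<mu> x"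
    "joint_cdf \<mu> x \<le> joint_cdf \<mu> (\<lambda>j. ereal (z j)) + (1 - joint_cdf \<mu> (\<lambda>_. ereal K))"
    if "vector_distribution \<mu>" for \<mu>
  proof -
    interpret vector_distribution \<mu> by fact
    have zx: "ereal (z j) = (if x j = \<infinity> then ereal K else x j)" for j
      using x[of j] by (cases "x j") (auto simp: z_def)
    show "joint_cdf \<mu> (\<lambda>j. ereal (z j)) \<le> joint_cdf \<mu> x"
      by (intro joint_cdf_mono) (simp add: zx)
    let ?B = "{y :: real ^ 'd. \<forall>j. ereal (y $ j) \<le> ereal K}"
    have "joint_cdf \<mu> x \<le> prob ({y. \<forall>j. ereal (y $ j) \<le> ereal (z j)} \<union> (space \<mu> - ?B))"
      unfolding joint_cdf_def by (intro finite_measure_mono) (auto simp: zx)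
    also have "\<dots> \<le> joint_cdf \<mu> (\<lambda>j. ereal (z j)) + prob (space \<mu> - ?B)"
      unfolding joint_cdf_def by (intro measure_Un_le) auto
    also have "prob (space \<mu> - ?B) = 1 - joint_cdf \<mu> (\<lambda>_. ereal K)"
      unfolding joint_cdf_def by (rule prob_compl) simp
    finally show "joint_cdf \<mu> x \<le> joint_cdf \<mu> (\<lambda>j. ereal (z j)) + (1 - joint_cdf \<mu> (\<lambda>_. ereal K))" .
  qed
  have "\<forall>\<^sub>F n in sequentially. \<bar>joint_cdf (P n) (\<lambda>j. ereal (z j)) - joint_cdf H (\<lambda>j. ereal (z j))\<bar> < e / 3"
    using tendstoD[OF conv[of z], of "e / 3"] \<open>e > 0\<close> by (simp add: dist_real_def)
  moreover have "\<forall>\<^sub>F n in sequentially. \<bar>joint_cdf (P n) (\<lambda>_. ereal K) - joint_cdf H (\<lambda>_. ereal K)\<bar> < e / 3"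
    using tendstoD[OF conv[of "\<lambda>_. K"], of "e / 3"] \<open>e > 0\<close> by (simp add: dist_real_def)
  ultimately have "\<forall>\<^sub>F n in sequentially. \<bar>joint_cdf (P n) x - joint_cdf H x\<bar> < e"
  proof eventually_elim
    case (elim n)
    then show ?case using sq[OF P, of n] sq[OF H] K by linarith
  qed
  then show "\<exists>no. \<forall>n\<ge>no. norm (joint_cdf (P n) x - joint_cdf H x) < e"
    by (simp add: eventually_sequentially)
qed

text \<open>
  The Lipschitz bound for \<open>P n\<close> is uniform in \<open>n\<close>, so only the margins matter, and there monotonicity
  encloses the moving argument between fixed ones.
\<close>

lemma joint_cdf_tendsto_moving:
  fixes P :: "nat \<Rightarrow> (real ^ 'd) measure"
  assumes P: "\<And>n. vector_distribution (P n)" and H: "vector_distribution H"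
    and conv: "\<And>x :: 'd \<Rightarrow> real. (\<lambda>n. joint_cdf (P n) (\<lambda>j. ereal (x j))) \<longlonglongrightarrow> joint_cdf H (\<lambda>j. ereal (x j))"
    and cont: "\<And>j x. isCont (cdf (margin H j)) x"
    and y: "\<And>j. y j \<noteq> -\<infinity>" and lim: "\<And>j. (\<lambda>n. Y n j) \<longlonglongrightarrow> y j"
  shows "(\<lambda>n. joint_cdf (P n) (Y n)) \<longlonglongrightarrow> joint_cdf H y"
proof -
  note ext = joint_cdf_tendsto_extended[OF P H conv]
  have ext1: "(\<lambda>n. joint_margin (P n) j x) \<longlonglongrightarrow> joint_margin H j x" if "x \<noteq> -\<infinity>" for j x
    unfolding joint_margin_def using that by (intro ext) auto
  interpret H: vector_distribution H by fact
  have marg: "(\<lambda>n. joint_margin (P n) j (Y n j)) \<longlonglongrightarrow> joint_margin H j (y j)" for j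
  proof (rule order_tendstoI)
    fix a assume a: "a < joint_margin H j (y j)"
    have "\<exists>z. ereal z < y j \<and> a < joint_margin H j (ereal z)"
    proof (cases "y j")
      case (real r)
      have "((\<lambda>z. joint_margin H j (ereal z)) \<longlongrightarrow> joint_margin H j (ereal r)) (at_left r)"
        using cont[of r j] 
        by (simp add: isCont_def filterlim_at_split H.cdf_margin)
      then have "\<forall>\<^sub>F z in at_left r. a < joint_margin H j (ereal z) \<and> z < r"
        using a real
        by (intro eventually_conj order_tendstoD(1)[of _ "joint_margin H j (ereal r)"])
          (auto simp: eventually_at_filter)
      then have "\<exists>z. a < joint_margin H j (ereal z) \<and> z < r"
        by (rule eventually_happens'[rotated]) simp
      then show ?thesis using real by auto
    next
      case PInf
      then have "\<forall>\<^sub>F z in at_top. a < joint_margin H j (ereal z)"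
        using a by (intro order_tendstoD[OF H.joint_margin_at_top]) auto
      then have "\<exists>z. a < joint_margin H j (ereal z)"
        by (rule eventually_happens'[rotated]) simp
      then show ?thesis using PInf by auto
    qed (use y in auto)
    then obtain z where z: "ereal z < y j" "a < joint_margin H j (ereal z)" by blast
    have "\<forall>\<^sub>F n in sequentially. ereal z < Y n j"
      using order_tendstoD(1)[OF lim z(1)] .
    moreover have "\<forall>\<^sub>F n in sequentially. a < joint_margin (P n) j (ereal z)"
      by (rule order_tendstoD(1)[OF ext1 z(2)]) simp
    ultimately show "\<forall>\<^sub>F n in sequentially. a < joint_margin (P n) j (Y n j)"
    proof eventually_elim
      case (elim n)
      then show ?case
        using vector_distribution.joint_margin_mono[OF P[of n], of "ereal z" "Y n j" j]
          by (meson less_imp_le less_le_trans)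
    qed
  next
    fix a assume a: "joint_margin H j (y j) < a"
    show "\<forall>\<^sub>F n in sequentially. joint_margin (P n) j (Y n j) < a"
    proof (cases "y j")
      case PInf
      then have "1 < a" using a by simp
      then show ?thesis
        using vector_distribution.joint_margin_le_1[OF P]
        by (intro always_eventually allI) (meson le_less_trans)
    next
      case (real r)
      have "((\<lambda>z. joint_margin H j (ereal z)) \<longlongrightarrow> joint_margin H j (ereal r)) (at_right r)"
        using cont[of r j] 
        by (simp add: isCont_def filterlim_at_split H.cdf_margin)
      then have "\<forall>\<^sub>F z in at_right r. joint_margin H j (ereal z) < a \<and> r < z"
        using a real
        by (intro eventually_conj order_tendstoD(2)[of _ "joint_margin H j (ereal r)"])
          (auto simp: eventually_at_filter)
      then have "\<exists>z. joint_margin H j (ereal z) < a \<and> r < z"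
        by (rule eventually_happens'[rotated]) simp
      then obtain z where z: "y j < ereal z" "joint_margin H j (ereal z) < a" using real by auto
      have "\<forall>\<^sub>F n in sequentially. Y n j < ereal z"
        using order_tendstoD(2)[OF lim z(1)] .
      moreover have "\<forall>\<^sub>F n in sequentially. joint_margin (P n) j (ereal z) < a"
        by (rule order_tendstoD(2)[OF ext1 z(2)]) simp
      ultimately show ?thesis
      proof eventually_elim
        case (elim n)
        then show ?case
          using vector_distribution.joint_margin_mono[OF P[of n], of "Y n j" "ereal z" j]
          by (meson less_imp_le le_less_trans)
      qed
    qed (use y in auto)
  qed
  have "(\<lambda>n. joint_cdf (P n) (Y n) - joint_cdf (P n) y) \<longlonglongrightarrow> 0"
  proof (rule Lim_null_comparison)
    show "\<forall>\<^sub>F n in sequentially. norm (joint_cdf (P n) (Y n) - joint_cdf (P n) y) \<le>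
        (\<Sum>j\<in>UNIV. \<bar>joint_margin (P n) j (Y n j) - joint_margin (P n) j (y j)\<bar>)"
      using vector_distribution.joint_cdf_lipschitz[OF P] by simp
    have "(\<lambda>n. \<Sum>j\<in>UNIV. \<bar>joint_margin (P n) j (Y n j) - joint_margin (P n) j (y j)\<bar>)
        \<longlonglongrightarrow> (\<Sum>j\<in>(UNIV :: 'd set). \<bar>joint_margin H j (y j) - joint_margin H j (y j)\<bar>)"
      by (intro tendsto_intros marg ext1 y)
    then show "(\<lambda>n. \<Sum>j\<in>UNIV. \<bar>joint_margin (P n) j (Y n j) - joint_margin (P n) j (y j)\<bar>) \<longlonglongrightarrow> 0"
      by simp
  qed
  with ext[of y, OF y] show ?thesis by (rule Lim_transform)
qed

lemma ereal_max_le_iff: "ereal (max s t) \<le> r \<longleftrightarrow> ereal s \<le> r \<and> ereal t \<le> r"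
  by (auto simp: max_def intro: order_trans[of "ereal s" "ereal t"] order_trans[of "ereal t" "ereal s"])

text \<open>
  Products of distribution functions are distribution functions: the maximum of two independent
  vectors has the product as its distribution function.
\<close>

lemma max_law_exists:
  assumes \<mu>: "vector_distribution \<mu>" and \<nu>: "vector_distribution \<nu>"
  shows "\<exists>\<rho>. vector_distribution \<rho> \<and> (\<forall>x. joint_cdf \<rho> x = joint_cdf \<mu> x * joint_cdf \<nu> x)"
proof -
  interpret \<mu>: vector_distribution \<mu> by fact
  interpret \<nu>: vector_distribution \<nu> by fact
  interpret P: pair_prob_space \<mu> \<nu> ..
  define f :: "(real ^ 'a) \<times> (real ^ 'a) \<Rightarrow> real ^ 'a" where "f = (\<lambda>(y, z). \<chi> j. max (y $ j) (z $ j))"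
  have f [measurable]: "f \<in> borel_measurable (\<mu> \<Otimes>\<^sub>M \<nu>)"
    unfolding f_def split_beta by (rule borel_measurable_vec_lambda) measurable
  have "vector_distribution (distr (\<mu> \<Otimes>\<^sub>M \<nu>) borel f)"
    by (intro vector_distribution.intro P.prob_space_distr f vector_distribution_axioms.intro) simp
  moreover have "joint_cdf (distr (\<mu> \<Otimes>\<^sub>M \<nu>) borel f) x = joint_cdf \<mu> x * joint_cdf \<nu> x" for x
  proof -
    let ?S = "{y :: real ^ 'a. \<forall>j. ereal (y $ j) \<le> x j}"
    have "joint_cdf (distr (\<mu> \<Otimes>\<^sub>M \<nu>) borel f) x = measure (\<mu> \<Otimes>\<^sub>M \<nu>) (f -` ?S \<inter> space (\<mu> \<Otimes>\<^sub>M \<nu>))"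
      unfolding joint_cdf_def by (subst measure_distr) auto
    also have "f -` ?S \<inter> space (\<mu> \<Otimes>\<^sub>M \<nu>) = ?S \<times> ?S"
      by (auto simp: f_def ereal_max_le_iff space_pair_measure)
    also have "measure (\<mu> \<Otimes>\<^sub>M \<nu>) (?S \<times> ?S) = measure \<mu> ?S * measure \<nu> ?S"
      by (simp add: measure_def \<nu>.emeasure_pair_measure_Times enn2real_mult)
    finally show ?thesis by (simp add: joint_cdf_def)
  qed
  ultimately show ?thesis by blast
qed

lemma power_law_exists:
  assumes "vector_distribution \<mu>"
  shows "\<exists>\<rho>. vector_distribution \<rho> \<and> (\<forall>x. joint_cdf \<rho> x = joint_cdf \<mu> x ^ Suc n)"
proof (induction n)
  case 0
  then show ?case using assms by auto
next
  case (Suc n)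
  then obtain \<rho> where "vector_distribution \<rho>" "\<forall>x. joint_cdf \<rho> x = joint_cdf \<mu> x ^ Suc n" by blast
  with max_law_exists[OF assms, of \<rho>] show ?case by simp
qed

lemma normalised_maximum_law_exists:
  fixes \<mu> :: "(real ^ 'd) measure" and a b :: "'d \<Rightarrow> real"
  assumes "vector_distribution \<mu>" and a: "\<And>j. a j > 0" and "n > 0"
  shows "\<exists>\<rho>. vector_distribution \<rho> \<and>
    (\<forall>x. joint_cdf \<rho> x = joint_cdf \<mu> (\<lambda>j. ereal (a j) * x j + ereal (b j)) ^ n)"
proof -
  obtain \<rho> where \<rho>: "vector_distribution \<rho>" "\<And>x. joint_cdf \<rho> x = joint_cdf \<mu> x ^ n"
    using power_law_exists[OF assms(1), of "n - 1"] \<open>n > 0\<close> by auto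
  interpret vector_distribution \<rho> by fact
  define f :: "real ^ 'd \<Rightarrow> real ^ 'd" where "f y = (\<chi> j. (y $ j - b j) / a j)" for y
  have f [measurable]: "f \<in> borel_measurable \<rho>"
    unfolding f_def by (rule borel_measurable_vec_lambda) measurable
  have "vector_distribution (distr \<rho> borel f)"
    by (intro vector_distribution.intro prob_space_distr f vector_distribution_axioms.intro) simp
  moreover have "joint_cdf (distr \<rho> borel f) x = joint_cdf \<rho> (\<lambda>j. ereal (a j) * x j + ereal (b j))" for x
  proof -
    have *: "ereal ((s - b j) / a j) \<le> r \<longleftrightarrow> ereal s \<le> ereal (a j) * r + ereal (b j)" for s r j
      using a[of j] by (cases r) (auto simp: field_simps)
    show ?thesis
      unfolding joint_cdf_def by (subst measure_distr) (auto simp: f_def *)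
  qed
  ultimately show ?thesis using \<rho>(2) by (intro exI[of _ "distr \<rho> borel f"]) simp
qed

text \<open>
  The law of \<open>(max Z - b) / a\<close> for \<open>n\<close> independent vectors \<open>Z\<close> with law \<open>\<mu>\<close>. For
  \<open>n = 0\<close>, where the power would not be a distribution function, only a probability
  measure is required.
\<close>

definition normalised_maximum_law ::
    "(real ^ 'd) measure \<Rightarrow> ('d \<Rightarrow> real) \<Rightarrow> ('d \<Rightarrow> real) \<Rightarrow> nat \<Rightarrow> (real ^ 'd) measure" where
  "normalised_maximum_law \<mu> a b n = (SOME \<rho>. vector_distribution \<rho> \<and>
     (n > 0 \<longrightarrow> (\<forall>x. joint_cdf \<rho> x = joint_cdf \<mu> (\<lambda>j. ereal (a j) * x j + ereal (b j)) ^ n)))"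

lemma normalised_maximum_law:
  assumes "vector_distribution \<mu>" "\<And>j. a j > 0"
  shows "vector_distribution (normalised_maximum_law \<mu> a b n)"
    and "n > 0 \<Longrightarrow> joint_cdf (normalised_maximum_law \<mu> a b n) x =
      joint_cdf \<mu> (\<lambda>j. ereal (a j) * x j + ereal (b j)) ^ n"
proof -
  have "\<exists>\<rho>. vector_distribution \<rho> \<and>
     (n > 0 \<longrightarrow> (\<forall>x. joint_cdf \<rho> x = joint_cdf \<mu> (\<lambda>j. ereal (a j) * x j + ereal (b j)) ^ n))"
    using normalised_maximum_law_exists[OF assms, where n = n and b = b] assms(1) by (cases "n = 0") auto
  from someI_ex[OF this]
  show "vector_distribution (normalised_maximum_law \<mu> a b n)"
    "n > 0 \<Longrightarrow> joint_cdf (normalised_maximum_law \<mu> a b n) x =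
      joint_cdf \<mu> (\<lambda>j. ereal (a j) * x j + ereal (b j)) ^ n"
    unfolding normalised_maximum_law_def by blast+
qed

lemma normalised_maximum_margin:
  fixes \<mu> :: "(real ^ 'd) measure"
  assumes "vector_distribution \<mu>" "\<And>j. a j > 0" "n > 0"
  shows "joint_margin (normalised_maximum_law \<mu> a b n) j x =
    joint_margin \<mu> j (ereal (a j) * x + ereal (b j)) ^ n"
proof -
  have "(\<lambda>i. ereal (a i) * ((\<lambda>_. \<infinity>)(j := x)) i + ereal (b i)) =
      (\<lambda>_. \<infinity>)(j := ereal (a j) * x + ereal (b j))"
    using assms(2) by (auto simp: fun_eq_iff) (metis less_irrefl)
  then show ?thesis
    unfolding joint_margin_def by (simp add: normalised_maximum_law[OF assms(1,2)] assms(3))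
qed

text \<open>
  Level 1 is included: the quantile is then \<open>\<infinity>\<close> if the margin stays below 1 on the real line.
\<close>

lemma (in vector_distribution) joint_margin_quantile:
  assumes cont: "\<And>x. isCont (cdf (margin \<mu> j)) x" and u: "0 < u" "u \<le> 1"
  shows "quantile (margin \<mu> j) u \<noteq> -\<infinity>" and "joint_margin \<mu> j (quantile (margin \<mu> j) u) = u"
proof -
  define S where "S = {x. u \<le> cdf (margin \<mu> j) x}"
  have q: "quantile (margin \<mu> j) u = (INF x\<in>S. ereal x)" by (simp add: quantile_def S_def)
  have "quantile (margin \<mu> j) u \<noteq> -\<infinity> \<and> joint_margin \<mu> j (quantile (margin \<mu> j) u) = u"
  proof (cases "S = {}")
    case True
    have "\<not> u < 1"
    proof
      assume "u < 1"
      then have "\<forall>\<^sub>F x in at_top. u < cdf (margin \<mu> j) x"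
        using order_tendstoD(1)[OF joint_margin_at_top] by (simp add: cdf_margin)
      then have "\<exists>x. u < cdf (margin \<mu> j) x" by (rule eventually_happens'[rotated]) simp
      with True show False by (auto simp: S_def dest: less_imp_le)
    qed
    then have "u = 1" using u by simp
    moreover have "quantile (margin \<mu> j) u = \<infinity>" using True q by (simp add: top_ereal_def)
    ultimately show ?thesis by simp
  next
    case False
    have mono: "cdf (margin \<mu> j) x \<le> cdf (margin \<mu> j) y" if "x \<le> y" for x y
      using that by (simp add: cdf_margin joint_margin_mono)
    have "\<forall>\<^sub>F x in at_bot. cdf (margin \<mu> j) x < u"
      using order_tendstoD(2)[OF joint_margin_at_bot \<open>0 < u\<close>] by (simp add: cdf_margin)
    then have "\<exists>l. cdf (margin \<mu> j) l < u" by (rule eventually_happens'[rotated]) simp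
    then obtain l where l: "cdf (margin \<mu> j) l < u" by blast
    have "bdd_below S"
    proof (rule bdd_belowI[of _ l])
      fix x assume "x \<in> S"
      then show "l \<le> x" using l mono[of x l] by (auto simp: S_def intro: ccontr)
    qed
    have "closed S"
    proof -
      have "S = cdf (margin \<mu> j) -` {u..}" by (auto simp: S_def)
      then show ?thesis
        using cont by (auto intro!: continuous_closed_vimage)
    qed
    define m where "m = Inf S"
    have m: "m \<in> S" unfolding m_def by (rule closed_contains_Inf) fact+
    have least: "m \<le> x" if "x \<in> S" for x
      unfolding m_def by (rule cInf_lower) fact+
    have "quantile (margin \<mu> j) u = ereal m"
      unfolding q
    proof (rule antisym)
      show "ereal m \<le> (INF x\<in>S. ereal x)" by (rule INF_greatest) (simp add: least)
    qed (rule INF_lower[OF m])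
    moreover have "cdf (margin \<mu> j) m = u"
    proof (rule antisym)
      have "(cdf (margin \<mu> j) \<longlongrightarrow> cdf (margin \<mu> j) m) (at_left m)"
        using cont[of m] by (simp add: isCont_def filterlim_at_split)
      moreover have "cdf (margin \<mu> j) x \<le> u" if "x < m" for x
        using least[of x] that by (force simp: S_def)
      then have "\<forall>\<^sub>F x in at_left m. cdf (margin \<mu> j) x \<le> u"
        by (auto simp: eventually_at_filter)
      ultimately show "cdf (margin \<mu> j) m \<le> u"
        by (intro tendsto_upperbound[where F = "at_left m"]) auto
      show "u \<le> cdf (margin \<mu> j) m" using m by (simp add: S_def)
    qed
    ultimately show ?thesis by (simp add: cdf_margin)
  qed
  then show "quantile (margin \<mu> j) u \<noteq> -\<infinity>" "joint_margin \<mu> j (quantile (margin \<mu> j) u) = u" by auto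
qed

text \<open>
  The quantiles of the values of the margins at \<open>x\<close> may differ from the coordinates of \<open>x\<close>, but the
  margins agree there, and the Lipschitz bound then gives equal values of the joint distribution function.
\<close>

lemma (in vector_distribution) joint_cdf_eq_copula:
  assumes cont: "\<And>j x. isCont (cdf (margin \<mu> j)) x"
    and pos: "\<And>j. 0 < joint_margin \<mu> j (x j)"
  shows "joint_cdf \<mu> x = copula \<mu> (\<lambda>j. joint_margin \<mu> j (x j))"
proof -
  have "joint_margin \<mu> j (quantile (margin \<mu> j) (joint_margin \<mu> j (x j))) = joint_margin \<mu> j (x j)" for j
    by (intro joint_margin_quantile cont pos joint_margin_le_1)
  then show ?thesis
    using joint_cdf_lipschitz[of x "\<lambda>j. quantile (margin \<mu> j) (joint_margin \<mu> j (x j))"]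
    by (simp add: copula_def)
qed

section \<open>Limits of joint distribution functions\<close>

text \<open>
  An order isomorphism of the extended real line onto the unit interval, together with its inverse on the
  interior.
\<close>

definition squash :: "ereal \<Rightarrow> real" where
  "squash x = (if x = \<infinity> then 1 else if x = -\<infinity> then 0 else 1 / 2 + arctan (real_of_ereal x) / pi)"

definition unsquash :: "real \<Rightarrow> real" where
  "unsquash u = tan (pi * (u - 1 / 2))"

lemma squash_simps [simp]:
  "squash (ereal r) = 1 / 2 + arctan r / pi" "squash \<infinity> = 1" "squash (-\<infinity>) = 0"
  by (simp_all add: squash_def)

lemma squash_bounds: "0 < squash (ereal r)" "squash (ereal r) < 1"
proof -
  have "- (pi / 2) < arctan r" "arctan r < pi / 2"
    using arctan_bounded[of r] by auto
  then show "0 < squash (ereal r)" "squash (ereal r) < 1"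
    by (simp_all add: field_simps)
qed

lemma squash_le_iff: "squash (ereal r) \<le> squash x \<longleftrightarrow> ereal r \<le> x"
proof (cases x)
  case (real s)
  have "arctan r / pi \<le> arctan s / pi \<longleftrightarrow> r \<le> s"
    using pi_gt_zero by (simp add: divide_le_cancel arctan_le_iff del: pi_gt_zero)
  with real show ?thesis by simp
next
  case PInf
  then show ?thesis using squash_bounds(2)[of r] by (simp del: squash_simps(1))
next
  case MInf
  then show ?thesis using squash_bounds(1)[of r] by (simp add: not_le del: squash_simps(1))
qed

lemma squash_less: "r < s \<Longrightarrow> squash (ereal r) < squash (ereal s)"
  unfolding not_le[symmetric] squash_le_iff by simp

lemma squash_unsquash:
  assumes "0 < u" "u < 1"
  shows "squash (ereal (unsquash u)) = u"
proof -
  have "pi * 0 < pi * u" "pi * u < pi * 1"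
    using assms by (auto intro!: mult_strict_left_mono)
  then have "- (pi / 2) < pi * (u - 1 / 2)" "pi * (u - 1 / 2) < pi / 2"
    by (simp_all add: algebra_simps)
  then have "arctan (unsquash u) = pi * (u - 1 / 2)"
    unfolding unsquash_def by (rule arctan_tan)
  then show ?thesis by simp
qed

text \<open>
  Each law \<open>Q n\<close> is moved into the open unit cube coordinatewise and from there to the unit interval by the Borel
  right inverse \<open>g\<close> of the curve \<open>\<psi>\<close>. The resulting laws \<open>\<nu> n\<close> are tight, and a weak
  limit \<open>N\<close> along a subsequence exists. Since \<open>\<psi>\<close> is continuous, orthants can be tested by continuous
  functions of the parameter, and continuity of \<open>v\<close> identifies the mass that \<open>N\<close> gives them. The limits of the
  margins at \<open>-\<infinity>\<close> and \<open>\<infinity>\<close> exclude mass on the boundary of the cube, so \<open>N\<close> can be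
  moved back.
\<close>

lemma limit_of_vector_distributions:
  fixes Q :: "nat \<Rightarrow> (real ^ 'd) measure" and v :: "('d \<Rightarrow> ereal) \<Rightarrow> real"
  assumes Q: "\<And>n. vector_distribution (Q n)"
    and conv: "\<And>x. (\<And>j. x j \<noteq> -\<infinity>) \<Longrightarrow> (\<lambda>n. joint_cdf (Q n) x) \<longlonglongrightarrow> v x"
    and cont: "\<And>j r. isCont (\<lambda>r. v ((\<lambda>_. \<infinity>)(j := ereal r))) r"
    and bot: "\<And>j. ((\<lambda>r. v ((\<lambda>_. \<infinity>)(j := ereal r))) \<longlongrightarrow> 0) at_bot"
    and top: "\<And>j. ((\<lambda>r. v ((\<lambda>_. \<infinity>)(j := ereal r))) \<longlongrightarrow> 1) at_top"
  shows "\<exists>V. vector_distribution V \<and> (\<forall>x. (\<forall>j. x j \<noteq> -\<infinity>) \<longrightarrow> joint_cdf V x = v x)"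
proof -
  interpret Q: vector_distribution "Q n" for n by fact
  define w where "w j r = v ((\<lambda>_. \<infinity>)(j := r))" for j r
  have w: "(\<lambda>n. joint_margin (Q n) j r) \<longlonglongrightarrow> w j r" if "r \<noteq> -\<infinity>" for j r
    unfolding joint_margin_def w_def using that by (intro conv) auto

  \<comment> \<open>The Lipschitz bound passes to the limit and makes \<open>v\<close> continuous under shifts.\<close>
  have lip: "\<bar>v x - v y\<bar> \<le> (\<Sum>j\<in>UNIV. \<bar>w j (x j) - w j (y j)\<bar>)"
    if "\<And>j. x j \<noteq> -\<infinity>" "\<And>j. y j \<noteq> -\<infinity>" for x y
  proof (rule LIMSEQ_le)
    show "(\<lambda>n. \<bar>joint_cdf (Q n) x - joint_cdf (Q n) y\<bar>) \<longlonglongrightarrow> \<bar>v x - v y\<bar>"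
      by (intro tendsto_intros conv that)
    show "(\<lambda>n. \<Sum>j\<in>UNIV. \<bar>joint_margin (Q n) j (x j) - joint_margin (Q n) j (y j)\<bar>)
        \<longlonglongrightarrow> (\<Sum>j\<in>UNIV. \<bar>w j (x j) - w j (y j)\<bar>)"
      by (intro tendsto_intros w that)
  qed (use Q.joint_cdf_lipschitz in blast)
  have shift: "((\<lambda>\<delta>. v (\<lambda>j. x j + ereal \<delta>)) \<longlongrightarrow> v x) (at 0)" if x: "\<And>j. x j \<noteq> -\<infinity>" for x
  proof -
    have "((\<lambda>\<delta>. v (\<lambda>j. x j + ereal \<delta>) - v x) \<longlongrightarrow> 0) (at 0)"
    proof (rule Lim_null_comparison)
      show "\<forall>\<^sub>F \<delta> in at 0. norm (v (\<lambda>j. x j + ereal \<delta>) - v x)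
          \<le> (\<Sum>j\<in>UNIV. \<bar>w j (x j + ereal \<delta>) - w j (x j)\<bar>)"
        using lip[of "\<lambda>j. x j + ereal _" x] x by (intro always_eventually allI) auto
      have "((\<lambda>\<delta>. w j (x j + ereal \<delta>)) \<longlongrightarrow> w j (x j)) (at 0)" for j
      proof (cases "x j")
        case (real r)
        have "((\<lambda>\<delta>. w j (ereal (r + \<delta>))) \<longlongrightarrow> w j (ereal r)) (at 0)"
          using cont[of r j] unfolding w_def isCont_def by (rule LIM_offset_zero)
        with real show ?thesis by simp
      qed (use x in auto)
      then have "((\<lambda>\<delta>. \<Sum>j\<in>UNIV. \<bar>w j (x j + ereal \<delta>) - w j (x j)\<bar>)
          \<longlongrightarrow> (\<Sum>j\<in>(UNIV :: 'd set). \<bar>w j (x j) - w j (x j)\<bar>)) (at 0)"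
        by (intro tendsto_intros)
      then show "((\<lambda>\<delta>. \<Sum>j\<in>UNIV. \<bar>w j (x j + ereal \<delta>) - w j (x j)\<bar>) \<longlongrightarrow> 0) (at 0)"
        by simp
    qed
    from tendsto_add[OF this tendsto_const[of "v x"]] show ?thesis by simp
  qed

  \<comment> \<open>Transport to the line, where \<open>\<psi> (g (S y)) = S y\<close> for every \<open>y\<close>.\<close>
  define \<psi> :: "real \<Rightarrow> real ^ 'd" where "\<psi> = schoenberg_curve"
  have \<psi>: "0 \<le> \<psi> t $ j" "\<psi> t $ j \<le> 1" for t j
    unfolding \<psi>_def by (rule schoenberg_curve_bounds)+
  have cont_\<psi>: "continuous_on A (\<lambda>t. \<psi> t $ j)" for A j
    unfolding \<psi>_def
    by (intro continuous_on_component continuous_on_subset[OF continuous_on_schoenberg_curve]) auto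
  have meas_\<psi> [measurable]: "(\<lambda>t. \<psi> t $ j) \<in> borel_measurable borel" for j
    by (intro borel_measurable_continuous_onI cont_\<psi>)
  obtain g where g [measurable]: "g \<in> borel_measurable borel" and g01: "\<And>y. g y \<in> {0..1}"
    and g_sec: "\<And>y. y \<in> \<psi> ` {0..1} \<Longrightarrow> \<psi> (g y) = y"
    by (rule continuous_curve_borel_section[of \<psi>])
      (auto simp: \<psi>_def intro: continuous_on_subset[OF continuous_on_schoenberg_curve])
  define S :: "real ^ 'd \<Rightarrow> real ^ 'd" where "S y = (\<chi> j. squash (ereal (y $ j)))" for y
  have meas_S [measurable]: "S \<in> borel_measurable borel"
    unfolding S_def squash_simps by (intro borel_measurable_vec_lambda) measurable
  have gS: "\<psi> (g (S y)) $ j = squash (ereal (y $ j))" for y j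
  proof -
    have "S y \<in> \<psi> ` {0..1}"
      unfolding \<psi>_def using squash_bounds by (intro schoenberg_curve_onto) (auto simp: S_def intro: less_imp_le)
    then show ?thesis by (simp add: g_sec S_def)
  qed
  define \<nu> where "\<nu> n = distr (Q n) borel (\<lambda>y. g (S y))" for n
  have rd: "real_distribution (\<nu> n)" for n
    unfolding \<nu>_def by (intro Q.real_distribution_distr) measurable
  have "tight \<nu>"
    unfolding tight_def
  proof (intro conjI allI impI rd)
    fix \<epsilon> :: real assume "\<epsilon> > 0"
    have "measure (\<nu> n) {-1<..1} = 1" for n
    proof -
      have "measure (\<nu> n) {-1<..1} = measure (Q n) ((\<lambda>y. g (S y)) -` {-1<..1} \<inter> space (Q n))"
        unfolding \<nu>_def by (subst measure_distr) auto
      also have "(\<lambda>y. g (S y)) -` {-1<..1} \<inter> space (Q n) = space (Q n)"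
      proof -
        have "-1 < g (S y)" "g (S y) \<le> 1" for y using g01[of "S y"] by auto
        then show ?thesis by auto
      qed
      finally show ?thesis by (simp only: Q.prob_space)
    qed
    then show "\<exists>a b. a < b \<and> (\<forall>n. 1 - \<epsilon> < measure (\<nu> n) {a<..b})"
      using \<open>\<epsilon> > 0\<close> by (intro exI[of _ "-1"] exI[of _ 1]) auto
  qed
  from tight_imp_convergent_subsubsequence[OF this strict_mono_id]
  obtain r N where r: "strict_mono r" and N: "real_distribution N"
    and weak: "weak_conv_m (\<nu> \<circ> r) N"
    by (auto simp: comp_def)
  interpret N: real_distribution N by fact

  define A where "A x = {t. \<forall>j. \<psi> t $ j \<le> squash (x j)}" for x
  have A_borel [measurable]: "A x \<in> sets borel" for x
    unfolding A_def by measurable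
  have \<nu>_A: "measure (\<nu> n) (A x) = joint_cdf (Q n) x" for n x
  proof -
    have "measure (\<nu> n) (A x) = measure (Q n) ((\<lambda>y. g (S y)) -` A x \<inter> space (Q n))"
      unfolding \<nu>_def by (subst measure_distr) auto
    also have "(\<lambda>y. g (S y)) -` A x \<inter> space (Q n) = {y. \<forall>j. ereal (y $ j) \<le> x j}"
      by (simp add: A_def gS squash_le_iff set_eq_iff del: squash_simps)
    finally show ?thesis by (simp add: joint_cdf_def)
  qed

  \<comment> \<open>The continuous function \<open>f\<close> lies between the indicators of the orthants at \<open>x\<close> and at
    \<open>x + \<delta>\<close>. An infinite coordinate imposes no constraint, and there any positive width \<open>\<eta> j\<close> will do.\<close>
  have sandwich: "N.prob (A x) \<le> v (\<lambda>j. x j + ereal \<delta>)" "v x \<le> N.prob (A (\<lambda>j. x j + ereal \<delta>))"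
    if x: "\<And>j. x j \<noteq> -\<infinity>" and "\<delta> > 0" for x \<delta>
  proof -
    let ?y = "\<lambda>j. x j + ereal \<delta>"
    define \<eta> where "\<eta> j = (if x j = \<infinity> then 1 else squash (?y j) - squash (x j))" for j
    have \<eta>: "\<eta> j > 0" for j
      using x[of j] squash_less[of _ "_ + \<delta>"] \<open>\<delta> > 0\<close>
      by (cases "x j") (auto simp: \<eta>_def simp del: squash_simps(1))
    define f where "f t = (\<Prod>j\<in>UNIV. max 0 (min 1 (1 - (\<psi> t $ j - squash (x j)) / \<eta> j)))" for t
    have cf: "continuous_on UNIV f"
      unfolding f_def using \<eta> by (intro continuous_intros cont_\<psi>) (metis less_irrefl)
    have f01: "0 \<le> f t" "f t \<le> 1" for t
      unfolding f_def by (intro prod_nonneg prod_le_1; simp)+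
    have low: "indicator (A x) t \<le> f t" for t
    proof (cases "t \<in> A x")
      case True
      then have "(\<psi> t $ j - squash (x j)) / \<eta> j \<le> 0" for j
        using \<eta>[of j] by (intro divide_nonpos_pos) (auto simp: A_def)
      then have "f t = 1" unfolding f_def by (intro prod.neutral) (simp add: max_def min_def)
      then show ?thesis by (simp add: indicator_def)
    qed (simp add: f01)
    have high: "f t \<le> indicator (A ?y) t" for t
    proof (cases "t \<in> A ?y")
      case False
      then obtain j where j: "squash (?y j) < \<psi> t $ j" by (auto simp: A_def not_le)
      with \<psi>(2)[of t j] have "x j \<noteq> \<infinity>" by auto
      with j have "\<eta> j \<le> \<psi> t $ j - squash (x j)" by (simp add: \<eta>_def)
      then have "1 - (\<psi> t $ j - squash (x j)) / \<eta> j \<le> 0"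
        using \<eta>[of j] by (simp add: pos_le_divide_eq)
      then have "max 0 (min 1 (1 - (\<psi> t $ j - squash (x j)) / \<eta> j)) = 0" by simp
      then have "f t = 0" unfolding f_def by (intro prod_zero bexI[of _ j]) auto
      then show ?thesis by simp
    qed (simp add: f01)
    have meas_f [measurable]: "f \<in> borel_measurable borel"
      by (rule borel_measurable_continuous_onI[OF cf])
    have int: "measure M (A x) \<le> integral\<^sup>L M f" "integral\<^sup>L M f \<le> measure M (A ?y)"
      if "real_distribution M" for M
    proof -
      interpret M: real_distribution M by fact
      have If: "integrable M f"
        by (rule M.integrable_const_bound[where B = 1]) (use f01 in auto)
      have "measure M (A x) = integral\<^sup>L M (indicator (A x))" by simp
      also have "\<dots> \<le> integral\<^sup>L M f"
        by (intro integral_mono If low) (auto simp: M.emeasure_eq_measure)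
      finally show "measure M (A x) \<le> integral\<^sup>L M f" .
      have "integral\<^sup>L M f \<le> integral\<^sup>L M (indicator (A ?y))"
        by (intro integral_mono If high) (auto simp: M.emeasure_eq_measure)
      then show "integral\<^sup>L M f \<le> measure M (A ?y)" by simp
    qed
    have lim: "(\<lambda>n. integral\<^sup>L (\<nu> (r n)) f) \<longlonglongrightarrow> integral\<^sup>L N f"
    proof -
      have "(\<lambda>n. integral\<^sup>L ((\<nu> \<circ> r) n) f) \<longlonglongrightarrow> integral\<^sup>L N f"
        by (rule weak_conv_imp_integral_bdd_continuous_conv[where B = 1])
          (use rd N weak cf f01 in \<open>auto simp: continuous_on_eq_continuous_at comp_def\<close>)
      then show ?thesis by simp
    qed
    have sub: "(\<lambda>n. joint_cdf (Q (r n)) z) \<longlonglongrightarrow> v z" if "\<And>j. z j \<noteq> -\<infinity>" for z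
      using LIMSEQ_subseq_LIMSEQ[OF conv[OF that] r] by (simp add: comp_def)
    have "integral\<^sup>L N f \<le> v ?y"
      by (rule LIMSEQ_le[OF lim sub]) (use x int(2)[OF rd] in \<open>auto simp: \<nu>_A\<close>)
    with int(1)[OF N] show "N.prob (A x) \<le> v ?y" by simp
    have "v x \<le> integral\<^sup>L N f"
      by (rule LIMSEQ_le[OF sub lim]) (use x int(1)[OF rd] in \<open>auto simp: \<nu>_A\<close>)
    with int(2)[OF N] show "v x \<le> N.prob (A ?y)" by simp
  qed
  have N_A: "N.prob (A x) = v x" if x: "\<And>j. x j \<noteq> -\<infinity>" for x
  proof (rule antisym)
    have "((\<lambda>\<delta>. v (\<lambda>j. x j + ereal \<delta>)) \<longlongrightarrow> v x) (at_right 0)"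
      using shift[OF x] by (simp add: filterlim_at_split)
    then show "N.prob (A x) \<le> v x"
      by (rule tendsto_lowerbound)
        (auto simp: eventually_at_filter intro!: always_eventually sandwich(1) x)
    have "((\<lambda>\<delta>. v (\<lambda>j. x j + ereal \<delta>)) \<longlongrightarrow> v x) (at_left 0)"
      using shift[OF x] by (simp add: filterlim_at_split)
    moreover have "v (\<lambda>j. x j + ereal \<delta>) \<le> N.prob (A x)" if "\<delta> < 0" for \<delta>
    proof -
      have "x j + ereal \<delta> + ereal (- \<delta>) = x j" for j using x[of j] by (cases "x j") auto
      then show ?thesis
        using sandwich(2)[of "\<lambda>j. x j + ereal \<delta>" "- \<delta>"] x that by auto
    qed
    ultimately show "v x \<le> N.prob (A x)"
      by (intro tendsto_upperbound[where F = "at_left 0"]) (auto simp: eventually_at_filter)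
  qed

  \<comment> \<open>The boundary of the cube is a null set because the margins are proper.\<close>
  have ae: "AE t in N. \<forall>j. 0 < \<psi> t $ j \<and> \<psi> t $ j < 1"
  proof -
    have "N.prob {t. \<psi> t $ j \<le> 0} \<le> 0" for j
    proof (rule tendsto_lowerbound[OF bot[of j]])
      show "\<forall>\<^sub>F r in at_bot. N.prob {t. \<psi> t $ j \<le> 0} \<le> v ((\<lambda>_. \<infinity>)(j := ereal r))"
      proof (intro always_eventually allI)
        fix r
        have "N.prob {t. \<psi> t $ j \<le> 0} \<le> N.prob (A ((\<lambda>_. \<infinity>)(j := ereal r)))"
          using squash_bounds[of r] \<psi>(2) by (intro N.finite_measure_mono) (auto simp: A_def)
        then show "N.prob {t. \<psi> t $ j \<le> 0} \<le> v ((\<lambda>_. \<infinity>)(j := ereal r))"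
          by (subst (asm) N_A) auto
      qed
    qed simp
    moreover have "N.prob {t. 1 \<le> \<psi> t $ j} \<le> 1 - 1" for j
    proof (rule tendsto_lowerbound[OF tendsto_diff[OF tendsto_const top[of j]]])
      show "\<forall>\<^sub>F r in at_top. N.prob {t. 1 \<le> \<psi> t $ j} \<le> 1 - v ((\<lambda>_. \<infinity>)(j := ereal r))"
      proof (intro always_eventually allI)
        fix r
        have "N.prob {t. 1 \<le> \<psi> t $ j} \<le> N.prob (space N - A ((\<lambda>_. \<infinity>)(j := ereal r)))"
          using squash_bounds[of r] by (intro N.finite_measure_mono) (auto simp: A_def simp del: squash_simps(1))
        also have "\<dots> = 1 - v ((\<lambda>_. \<infinity>)(j := ereal r))"
          by (subst N.prob_compl) (auto simp: N_A)
        finally show "N.prob {t. 1 \<le> \<psi> t $ j} \<le> 1 - v ((\<lambda>_. \<infinity>)(j := ereal r))" .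
      qed
    qed simp
    ultimately have "{t. \<psi> t $ j \<le> 0} \<in> null_sets N" "{t. 1 \<le> \<psi> t $ j} \<in> null_sets N" for j
      by (auto simp: null_sets_def N.emeasure_eq_measure measure_le_0_iff)
    then have "AE t in N. 0 < \<psi> t $ j" "AE t in N. \<psi> t $ j < 1" for j
      by (auto intro: AE_I'[of "{t. \<psi> t $ j \<le> 0}"] AE_I'[of "{t. 1 \<le> \<psi> t $ j}"] simp: not_less)
    then show ?thesis by (simp add: AE_conj_iff AE_all_countable)
  qed
  define h :: "real \<Rightarrow> real ^ 'd" where "h t = (\<chi> j. unsquash (\<psi> t $ j))" for t
  have meas_h [measurable]: "h \<in> borel_measurable borel"
    unfolding h_def unsquash_def tan_def by (intro borel_measurable_vec_lambda) measurable
  show ?thesis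
  proof (intro exI[of _ "distr N borel h"] conjI allI impI)
    show "vector_distribution (distr N borel h)"
      by (intro vector_distribution.intro N.prob_space_distr vector_distribution_axioms.intro) auto
    fix x :: "'d \<Rightarrow> ereal" assume x: "\<forall>j. x j \<noteq> -\<infinity>"
    have "joint_cdf (distr N borel h) x = N.prob (h -` {y. \<forall>j. ereal (y $ j) \<le> x j} \<inter> space N)"
      unfolding joint_cdf_def by (subst measure_distr) auto
    also have "\<dots> = N.prob (A x)"
    proof (rule N.finite_measure_eq_AE)
      show "AE t in N. t \<in> h -` {y. \<forall>j. ereal (y $ j) \<le> x j} \<inter> space N \<longleftrightarrow> t \<in> A x"
        using ae
      proof eventually_elim
        case (elim t)
        then show ?case
          by (simp add: h_def A_def squash_le_iff[symmetric] squash_unsquash del: squash_simps)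
      qed
    qed measurable
    finally show "joint_cdf (distr N borel h) x = v x" using N_A x by simp
  qed
qed

section \<open>Extreme value margins and their normalisation\<close>

lemma isCont_gumbel: "isCont gumbel x"
  unfolding gumbel_def by (intro continuous_intros)

lemma isCont_weibull:
  assumes "\<alpha> > 0"
  shows "isCont (weibull \<alpha>) x"
proof -
  have *: "weibull \<alpha> = (\<lambda>x. exp (- (max 0 (- x) powr \<alpha>)))"
    using assms by (auto simp: weibull_def fun_eq_iff)
  have "((\<lambda>x. exp (- (max 0 (- x) powr \<alpha>))) \<longlongrightarrow> exp (- (max 0 (- x) powr \<alpha>))) (at x)"
    using assms by (intro tendsto_intros tendsto_powr') auto
  then show ?thesis unfolding * isCont_def .
qed

text \<open>
  From \<open>exp (- u) \<le> 1 / u\<close>; this bound gives the continuity at 0.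
\<close>

lemma frechet_le_powr:
  assumes "\<alpha> > 0"
  shows "frechet \<alpha> x \<le> max 0 x powr \<alpha>"
proof (cases "x > 0")
  case True
  then have "x powr - \<alpha> \<le> exp (x powr - \<alpha>)"
    using exp_ge_add_one_self[of "x powr - \<alpha>"] by linarith
  with True show ?thesis
    by (simp add: frechet_def exp_minus powr_minus field_simps)
qed (simp add: frechet_def)

lemma frechet_nonneg: "0 \<le> frechet \<alpha> x"
  by (simp add: frechet_def)

lemma isCont_frechet:
  assumes "\<alpha> > 0"
  shows "isCont (frechet \<alpha>) x"
proof -
  consider "x < 0" | "x = 0" | "x > 0" by linarith
  then show ?thesis
  proof cases
    case 1
    then have "\<forall>\<^sub>F y in nhds x. frechet \<alpha> y = 0"
      using eventually_nhds_in_open[of "{..<0}" x] by (auto simp: frechet_def elim: eventually_mono)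
    then show ?thesis by (simp add: isCont_cong[of "frechet \<alpha>" "\<lambda>_. 0"])
  next
    case 2
    have "((\<lambda>y. max 0 y powr \<alpha>) \<longlongrightarrow> max 0 0 powr \<alpha>) (at 0)"
      using assms by (intro tendsto_intros tendsto_powr') auto
    then have "(frechet \<alpha> \<longlongrightarrow> 0) (at 0)"
      using frechet_nonneg frechet_le_powr[OF assms] assms
      by (intro tendsto_sandwich[of "\<lambda>_. 0" "frechet \<alpha>" "at 0" "\<lambda>y. max 0 y powr \<alpha>"]) auto
    then show ?thesis using 2 by (simp add: isCont_def frechet_def)
  next
    case 3
    then have "\<forall>\<^sub>F y in nhds x. frechet \<alpha> y = exp (- (y powr - \<alpha>))"
      using eventually_nhds_in_open[of "{0<..}" x] by (auto simp: frechet_def elim: eventually_mono)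
    then show ?thesis
      using 3 by (subst isCont_cong[of "frechet \<alpha>" "\<lambda>y. exp (- (y powr - \<alpha>))"]) (auto intro!: continuous_intros)
  qed
qed

lemma frechet_strict_mono:
  assumes "\<alpha> > 0" "x < y" "0 < y"
  shows "frechet \<alpha> x < frechet \<alpha> y"
proof (cases "0 < x")
  case True
  then have "y powr - \<alpha> < x powr - \<alpha>"
    using assms by (intro powr_less_mono2_neg) auto
  with True assms show ?thesis by (simp add: frechet_def)
qed (use assms in \<open>simp add: frechet_def\<close>)

lemma frechet_scale:
  assumes "s > 0"
  shows "frechet \<alpha> (s * x) = frechet \<alpha> x powr (s powr - \<alpha>)"
  using assms by (auto simp: frechet_def zero_less_mult_iff powr_mult exp_powr_real mult.commute)

text \<open>
  A sequence of maxima of \<open>k n\<close> instead of \<open>n\<close> variables, with the same normalisation. After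
  taking logarithms, only the asymptotic ratio of the two numbers matters.
\<close>

lemma power_subexponent_limit:
  fixes q :: "nat \<Rightarrow> real"
  assumes q: "\<And>n. 0 \<le> q n" and lim: "(\<lambda>n. q n ^ n) \<longlonglongrightarrow> p" and "p > 0"
    and k: "(\<lambda>n. real (k n) / real n) \<longlonglongrightarrow> \<rho>"
  shows "(\<lambda>n. q n ^ k n) \<longlonglongrightarrow> p powr \<rho>"
proof -
  have "(\<lambda>n. exp (real (k n) / real n * ln (q n ^ n))) \<longlonglongrightarrow> exp (\<rho> * ln p)"
    using \<open>p > 0\<close> by (intro tendsto_intros k lim) auto
  moreover have "\<forall>\<^sub>F n in sequentially. exp (real (k n) / real n * ln (q n ^ n)) = q n ^ k n"
    using order_tendstoD(1)[OF lim \<open>p > 0\<close>] eventually_gt_at_top[of 0]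
  proof eventually_elim
    case (elim n)
    then have "q n > 0" using q[of n] by (cases "q n = 0") (auto simp: power_0_left)
    with elim show ?case by (simp add: ln_realpow exp_of_nat_mult)
  qed
  ultimately show ?thesis
    using \<open>p > 0\<close> by (auto simp: powr_def intro: Lim_transform_eventually)
qed

lemma div2_ratio_limit: "(\<lambda>n. real (n div 2) / real n) \<longlonglongrightarrow> 1 / 2"
proof (rule tendsto_sandwich[of "\<lambda>n. 1 / 2 - (1 / 2) / real n" _ _ "\<lambda>_. 1 / 2"])
  show "\<forall>\<^sub>F n in sequentially. 1 / 2 - (1 / 2) / real n \<le> real (n div 2) / real n"
    using eventually_gt_at_top[of 0]
  proof eventually_elim
    case (elim n)
    have "real n - 1 \<le> 2 * real (n div 2)" by linarith
    then have "(real n - 1) / 2 / real n \<le> real (n div 2) / real n"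
      by (intro divide_right_mono) auto
    with elim show ?case by (simp add: diff_divide_distrib)
  qed
  show "\<forall>\<^sub>F n in sequentially. real (n div 2) / real n \<le> 1 / 2"
    by (intro always_eventually allI) (simp add: divide_le_eq; linarith)
  show "(\<lambda>n. 1 / 2 - (1 / 2) / real n) \<longlonglongrightarrow> 1 / 2"
    using tendsto_diff[OF tendsto_const lim_const_over_n[of "1 / 2"], of "1 / 2"] by simp
qed simp

lemma filterlim_div2: "filterlim (\<lambda>n :: nat. n div 2) sequentially sequentially"
  unfolding filterlim_at_top
proof
  fix Z :: nat
  show "\<forall>\<^sub>F n in sequentially. Z \<le> n div 2"
    using eventually_ge_at_top[of "2 * Z"] by eventually_elim linarith
qed

text \<open>
  The uniqueness part of convergence of types: monotone functions that converge to \<open>\<phi>\<close> force their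
  arguments to converge wherever \<open>\<phi>\<close> separates a point from all others.
\<close>

lemma monotone_argument_limit:
  fixes f :: "nat \<Rightarrow> real \<Rightarrow> real"
  assumes mono: "\<And>n. mono (f n)"
    and lim: "\<And>y. (\<lambda>n. f n y) \<longlonglongrightarrow> \<phi> y" and limT: "(\<lambda>n. f n (T n)) \<longlonglongrightarrow> \<phi> t"
    and strict: "\<And>l. l < t \<Longrightarrow> \<phi> l < \<phi> t" "\<And>u. t < u \<Longrightarrow> \<phi> t < \<phi> u"
  shows "T \<longlonglongrightarrow> t"
proof (rule order_tendstoI)
  fix l assume "l < t"
  then obtain m where "\<phi> l < m" "m < \<phi> t" using strict(1) dense by blast
  then have "\<forall>\<^sub>F n in sequentially. f n l < m \<and> m < f n (T n)"
    using lim limT by (intro eventually_conj order_tendstoD)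
  then show "\<forall>\<^sub>F n in sequentially. l < T n"
  proof eventually_elim
    case (elim n)
    show ?case using monoD[OF mono, of "T n" l n] elim by (rule_tac ccontr) auto
  qed
next
  fix u assume "t < u"
  then obtain m where "\<phi> t < m" "m < \<phi> u" using strict(2) dense by blast
  then have "\<forall>\<^sub>F n in sequentially. f n (T n) < m \<and> m < f n u"
    using lim limT by (intro eventually_conj order_tendstoD)
  then show "\<forall>\<^sub>F n in sequentially. T n < u"
  proof eventually_elim
    case (elim n)
    show ?case using monoD[OF mono, of u "T n" n] elim by (rule_tac ccontr) auto
  qed
qed

text \<open>
  The factor \<open>\<kappa>\<close> is gained at each halving, and the errors add up to a geometric series. With
  \<open>d = e * (1 - \<kappa>) / 2\<close>, the number \<open>e / 2\<close> is the fixed point of \<open>y \<mapsto> \<kappa> * y + d\<close>.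
\<close>

lemma halving_recursion_tendsto_0:
  fixes \<beta> \<delta> :: "nat \<Rightarrow> real"
  assumes rec: "\<forall>\<^sub>F n in sequentially. \<bar>\<beta> n\<bar> \<le> \<kappa> * \<bar>\<beta> (n div 2)\<bar> + \<delta> n"
    and \<kappa>: "0 \<le> \<kappa>" "\<kappa> < 1" and \<delta>: "\<delta> \<longlonglongrightarrow> 0"
  shows "\<beta> \<longlonglongrightarrow> 0"
proof (rule tendstoI)
  fix e :: real assume "e > 0"
  define d where "d = e * (1 - \<kappa>) / 2"
  have "d > 0" using \<open>e > 0\<close> \<kappa> by (simp add: d_def)
  have fix_d: "\<kappa> * (e / 2) + d = e / 2" by (simp add: d_def field_simps)
  have "\<forall>\<^sub>F n in sequentially. \<bar>\<beta> n\<bar> \<le> \<kappa> * \<bar>\<beta> (n div 2)\<bar> + d"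
    using rec order_tendstoD(2)[OF \<delta> \<open>d > 0\<close>] by eventually_elim simp
  then obtain N where N: "\<And>n. n \<ge> N \<Longrightarrow> \<bar>\<beta> n\<bar> \<le> \<kappa> * \<bar>\<beta> (n div 2)\<bar> + d"
    by (auto simp: eventually_sequentially)
  define C where "C = (\<Sum>i\<le>N. \<bar>\<beta> i\<bar>)"
  have "C \<ge> 0" by (simp add: C_def sum_nonneg)
  have bound: "\<bar>\<beta> n\<bar> \<le> C + e / 2" for n
  proof (induction n rule: less_induct)
    case (less n)
    show ?case
    proof (cases "n \<le> N")
      case True
      then have "\<bar>\<beta> n\<bar> \<le> C" unfolding C_def by (intro member_le_sum) auto
      then show ?thesis using \<open>e > 0\<close> by simp
    next
      case False
      then have "\<bar>\<beta> n\<bar> \<le> \<kappa> * \<bar>\<beta> (n div 2)\<bar> + d" by (intro N) simp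
      also have "\<dots> \<le> \<kappa> * (C + e / 2) + d"
        using False \<kappa> by (intro add_right_mono mult_left_mono less) auto
      also have "\<dots> \<le> C + e / 2"
        using mult_right_mono[of \<kappa> 1 C] \<kappa> \<open>C \<ge> 0\<close> fix_d by (simp add: distrib_left)
      finally show ?thesis .
    qed
  qed
  have decay: "\<forall>\<^sub>F n in sequentially. \<bar>\<beta> n\<bar> \<le> \<kappa> ^ k * C + e / 2" for k
  proof (induction k)
    case 0
    then show ?case using bound by simp
  next
    case (Suc k)
    have "\<forall>\<^sub>F n in sequentially. \<bar>\<beta> (n div 2)\<bar> \<le> \<kappa> ^ k * C + e / 2"
      using eventually_compose_filterlim[OF Suc filterlim_div2] .
    then show ?case using eventually_ge_at_top[of N]
    proof eventually_elim
      case (elim n)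
      have "\<bar>\<beta> n\<bar> \<le> \<kappa> * \<bar>\<beta> (n div 2)\<bar> + d" using elim by (intro N)
      also have "\<dots> \<le> \<kappa> * (\<kappa> ^ k * C + e / 2) + d"
        using elim \<kappa> by (intro add_right_mono mult_left_mono)
      also have "\<dots> = \<kappa> ^ Suc k * C + e / 2" using fix_d by (simp add: distrib_left)
      finally show ?case .
    qed
  qed
  have "(\<lambda>k. \<kappa> ^ k * C) \<longlonglongrightarrow> 0 * C"
    using \<kappa> by (intro tendsto_intros LIMSEQ_realpow_zero)
  then have "\<forall>\<^sub>F k in sequentially. \<kappa> ^ k * C < e / 2"
    using \<open>e > 0\<close> by (intro order_tendstoD) auto
  then obtain k where "\<kappa> ^ k * C < e / 2" by (auto simp: eventually_sequentially)
  with decay[of k] show "\<forall>\<^sub>F n in sequentially. dist (\<beta> n) 0 < e"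
    by (auto simp: dist_real_def elim!: eventually_mono)
qed

text \<open>
  The normalisations \<open>(a n, b n)\<close> and \<open>(a m, b m)\<close> with \<open>m = n div 2\<close> are compared through the affine map
  \<open>T\<close> between them. It converges to multiplication by \<open>A = 2 powr (1 / \<alpha>)\<close> because the square root
  of the Frechet distribution function is its rescaling by \<open>A\<close>. So \<open>a n / a m\<close> tends to \<open>A > 1\<close> and
  \<open>(b n - b m) / a m\<close> to 0, which is a contracting recursion for \<open>b n / a n\<close>.
\<close>

lemma frechet_location_negligible:
  fixes F :: "real \<Rightarrow> real" and a b :: "nat \<Rightarrow> real"
  assumes F: "mono F" "\<And>x. 0 \<le> F x" and a: "\<And>n. a n > 0" and "\<alpha> > 0"
    and lim: "\<And>x. (\<lambda>n. F (a n * x + b n) ^ n) \<longlonglongrightarrow> frechet \<alpha> x"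
  shows "(\<lambda>n. b n / a n) \<longlonglongrightarrow> 0"
proof -
  define m where "m n = n div 2" for n :: nat
  define T where "T x n = (a n * x + b n - b (m n)) / a (m n)" for x n
  define A where "A = 2 powr (1 / \<alpha>)"
  have "A > 1" using \<open>\<alpha> > 0\<close> by (simp add: A_def)
  have A_pow: "A powr - \<alpha> = 1 / 2"
    using \<open>\<alpha> > 0\<close> by (simp add: A_def powr_powr powr_minus_divide)
  have T: "T x \<longlonglongrightarrow> A * x" if "x > 0" for x
  proof (rule monotone_argument_limit[where f = "\<lambda>n y. F (a (m n) * y + b (m n)) ^ m n" and \<phi> = "frechet \<alpha>"])
    show "mono (\<lambda>y. F (a (m n) * y + b (m n)) ^ m n)" for n
      using a[of "m n"] F by (intro monoI power_mono monoD[OF F(1)] F(2)) auto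
    show "(\<lambda>n. F (a (m n) * y + b (m n)) ^ m n) \<longlonglongrightarrow> frechet \<alpha> y" for y
      using filterlim_compose[OF lim filterlim_div2] by (simp add: m_def)
    have "(\<lambda>n. F (a n * x + b n) ^ m n) \<longlonglongrightarrow> frechet \<alpha> x powr (1 / 2)"
      unfolding m_def
      by (rule power_subexponent_limit[OF F(2) lim _ div2_ratio_limit])
        (use \<open>x > 0\<close> in \<open>simp add: frechet_def\<close>)
    also have "frechet \<alpha> x powr (1 / 2) = frechet \<alpha> (A * x)"
      using \<open>A > 1\<close> by (subst frechet_scale) (auto simp: A_pow)
    also have "(\<lambda>n. F (a n * x + b n) ^ m n) = (\<lambda>n. F (a (m n) * T x n + b (m n)) ^ m n)"
      using a by (auto simp: T_def fun_eq_iff less_imp_neq[symmetric])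
    finally show "(\<lambda>n. F (a (m n) * T x n + b (m n)) ^ m n) \<longlonglongrightarrow> frechet \<alpha> (A * x)" .
    have "A * x > 0" using \<open>A > 1\<close> that by simp
    then show "l < A * x \<Longrightarrow> frechet \<alpha> l < frechet \<alpha> (A * x)"
      "A * x < u \<Longrightarrow> frechet \<alpha> (A * x) < frechet \<alpha> u" for l u
      using \<open>\<alpha> > 0\<close> by (auto intro: frechet_strict_mono)
  qed
  have "(\<lambda>n. T 2 n - T 1 n) \<longlonglongrightarrow> A * 2 - A * 1"
    by (intro tendsto_diff T) auto
  moreover have "T 2 n - T 1 n = a n / a (m n)" for n
    using a[of "m n"] by (simp add: T_def field_simps)
  ultimately have "(\<lambda>n. a n / a (m n)) \<longlonglongrightarrow> A" by simp
  then have "(\<lambda>n. inverse (a n / a (m n))) \<longlonglongrightarrow> inverse A"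
    using \<open>A > 1\<close> by (intro tendsto_inverse) auto
  then have scale: "(\<lambda>n. a (m n) / a n) \<longlonglongrightarrow> 1 / A" by (simp add: inverse_eq_divide)
  have "(\<lambda>n. 2 * T 1 n - T 2 n) \<longlonglongrightarrow> 2 * (A * 1) - A * 2"
    by (intro tendsto_intros T) auto
  then have "(\<lambda>n. \<bar>(2 * T 1 n - T 2 n) * (a (m n) / a n)\<bar>) \<longlonglongrightarrow> \<bar>(2 * (A * 1) - A * 2) * (1 / A)\<bar>"
    by (rule tendsto_rabs[OF tendsto_mult[OF _ scale]])
  then have \<delta>: "(\<lambda>n. \<bar>(2 * T 1 n - T 2 n) * (a (m n) / a n)\<bar>) \<longlonglongrightarrow> 0" by simp
  define \<kappa> where "\<kappa> = (1 / A + 1) / 2"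
  have \<kappa>: "0 \<le> \<kappa>" "\<kappa> < 1" "1 / A < \<kappa>" using \<open>A > 1\<close> by (auto simp: \<kappa>_def field_simps)
  show ?thesis
  proof (rule halving_recursion_tendsto_0[OF _ \<kappa>(1,2) \<delta>])
    show "\<forall>\<^sub>F n in sequentially. \<bar>b n / a n\<bar> \<le>
        \<kappa> * \<bar>b (n div 2) / a (n div 2)\<bar> + \<bar>(2 * T 1 n - T 2 n) * (a (m n) / a n)\<bar>"
      using order_tendstoD(2)[OF scale \<kappa>(3)]
    proof eventually_elim
      case (elim n)
      have "b n / a n = a (m n) / a n * (b (m n) / a (m n)) + (2 * T 1 n - T 2 n) * (a (m n) / a n)"
        using a[of n] a[of "m n"] by (simp add: T_def field_simps)
      then have "\<bar>b n / a n\<bar> \<le> \<bar>a (m n) / a n * (b (m n) / a (m n))\<bar> + \<bar>(2 * T 1 n - T 2 n) * (a (m n) / a n)\<bar>"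
        by (metis abs_triangle_ineq)
      also have "\<bar>a (m n) / a n * (b (m n) / a (m n))\<bar> = a (m n) / a n * \<bar>b (m n) / a (m n)\<bar>"
        using a[of n] a[of "m n"] by (simp add: abs_mult)
      also have "\<dots> \<le> \<kappa> * \<bar>b (m n) / a (m n)\<bar>"
        using elim by (intro mult_right_mono) auto
      finally show ?case by (simp add: m_def)
    qed
  qed
qed

text \<open>
  Iterating the inequality bounds \<open>F x\<close> by \<open>F (x / c ^ k)\<close>, whose argument tends to \<open>-\<infinity>\<close>.
\<close>

lemma scaled_cdf_vanishes_on_negatives:
  fixes F :: "real \<Rightarrow> real"
  assumes F: "\<And>x. 0 \<le> F x" and bot: "(F \<longlongrightarrow> 0) at_bot" and c: "0 < c" "c < 1"
    and le: "\<And>x. F x \<le> F (x / c)" and "x < 0"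
  shows "F x = 0"
proof -
  have "F x \<le> F (x / c ^ k)" for k
  proof (induction k)
    case (Suc k)
    then show ?case using le[of "x / c ^ k"] by (simp add: field_simps)
  qed simp
  moreover have "filterlim (\<lambda>k. x / c ^ k) at_bot sequentially"
  proof -
    have "filterlim (\<lambda>k. (1 / c) ^ k) at_top sequentially"
      using c filterlim_realpow_sequentially_gt1[of "1 / c"]
      by (intro filterlim_at_infinity_imp_filterlim_at_top always_eventually) auto
    then show ?thesis
      using \<open>x < 0\<close> filterlim_tendsto_neg_mult_at_bot[OF tendsto_const \<open>x < 0\<close>]
      by (auto simp: power_one_over divide_inverse power_inverse)
  qed
  ultimately have "F x \<le> 0"
    by (intro tendsto_lowerbound[OF filterlim_compose[OF bot]] always_eventually allI) auto
  with F[of x] show ?thesis by simp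
qed

text \<open>
  Where the limit is positive, the argument of \<open>F\<close> cannot be negative infinitely often. At the point
  \<open>- K\<close> this reads \<open>b n / a n \<ge> K\<close> for large \<open>n\<close>.
\<close>

lemma location_dominates_scale:
  fixes F :: "real \<Rightarrow> real" and a b :: "nat \<Rightarrow> real"
  assumes F: "\<And>x. x < 0 \<Longrightarrow> F x = 0" and a: "\<And>n. a n > 0"
    and lim: "\<And>x. (\<lambda>n. F (a n * x + b n) ^ n) \<longlonglongrightarrow> \<phi> x" and pos: "\<And>x. \<phi> x > 0"
  shows "filterlim (\<lambda>n. b n / a n) at_top sequentially"
  unfolding filterlim_at_top
proof
  fix K :: real
  show "\<forall>\<^sub>F n in sequentially. K \<le> b n / a n"
    using order_tendstoD(1)[OF lim pos, of "- K"] eventually_gt_at_top[of 0]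
  proof eventually_elim
    case (elim n)
    then have "\<not> a n * - K + b n < 0" using F by (auto simp: power_0_left)
    then show ?case using a[of n] by (simp add: field_simps)
  qed
qed

text \<open>
  Comparison with \<open>(1 - K / n) ^ n\<close>.
\<close>

lemma power_lower_bound_limit:
  fixes f :: "nat \<Rightarrow> real"
  assumes lim: "(\<lambda>n. f n ^ n) \<longlonglongrightarrow> h" and K: "\<forall>\<^sub>F n in sequentially. real n * (1 - f n) \<le> K"
  shows "exp (- K) \<le> h"
proof (rule tendsto_le[OF _ lim tendsto_exp_limit_sequentially[of "- K"]])
  show "\<forall>\<^sub>F n in sequentially. (1 + - K / real n) ^ n \<le> f n ^ n"
    using K eventually_gt_at_top[of 0] eventually_ge_at_top[of "nat \<lceil>K\<rceil>"]
  proof eventually_elim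
    case (elim n)
    then have "K \<le> real n" by linarith
    with elim show ?case by (intro power_mono) (auto simp: field_simps)
  qed
qed simp

section \<open>Attraction of the innovations of a max-autoregression\<close>

text \<open>
  The process enters only through the functional equation \<open>recursion\<close>; the rest is a statement about
  distribution functions.
\<close>

locale attracted_max_autoregression =
  F: vector_distribution F + G: vector_distribution G + H: vector_distribution H
  for F G H :: "(real ^ 'd) measure" +
  fixes c \<alpha> :: "'d \<Rightarrow> real" and a b :: "nat \<Rightarrow> 'd \<Rightarrow> real"
  assumes c: "0 < c j" "c j < 1"
    and recursion: "joint_cdf F x = joint_cdf F (\<lambda>j. ereal (1 / c j) * x j) * joint_cdf G x"
    and \<alpha>: "\<alpha> j > 0"
    and extreme_margins: "cdf (margin H j) \<in> {gumbel, weibull (\<alpha> j), frechet (\<alpha> j)}"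
    and a: "a n j > 0"
    and attraction: "(\<lambda>n. joint_cdf F (\<lambda>j. ereal (a n j * y j + b n j)) ^ n)
      \<longlonglongrightarrow> joint_cdf H (\<lambda>j. ereal (y j))"
begin

definition heavy :: "'d \<Rightarrow> bool" where
  "heavy j \<longleftrightarrow> cdf (margin H j) = frechet (\<alpha> j)"

definition margin_power :: "'d \<Rightarrow> real" where
  "margin_power j = (if heavy j then 1 - c j powr \<alpha> j else 1)"

text \<open>
  The limit of the shrunk arguments at which the functional equation evaluates \<open>P n\<close>.
\<close>

definition dilate :: "('d \<Rightarrow> ereal) \<Rightarrow> 'd \<Rightarrow> ereal" where
  "dilate x j = (if heavy j then ereal (1 / c j) * x j else \<infinity>)"

text \<open>
  Where a margin of \<open>H\<close> vanishes, the quotient can be \<open>0 / 0\<close>.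
\<close>

definition limit_cdf :: "('d \<Rightarrow> ereal) \<Rightarrow> real" where
  "limit_cdf x = (if \<forall>j. 0 < joint_margin H j (x j) then joint_cdf H x / joint_cdf H (dilate x) else 0)"

abbreviation "P n \<equiv> normalised_maximum_law F (a n) (b n) n"
abbreviation "Q n \<equiv> normalised_maximum_law G (a n) (b n) n"

lemma P: "vector_distribution (P n)" and Q: "vector_distribution (Q n)"
  by (simp_all add: normalised_maximum_law F.vector_distribution_axioms G.vector_distribution_axioms a)

lemma joint_cdf_P: "n > 0 \<Longrightarrow> joint_cdf (P n) x = joint_cdf F (\<lambda>j. ereal (a n j) * x j + ereal (b n j)) ^ n"
  and joint_cdf_Q: "n > 0 \<Longrightarrow> joint_cdf (Q n) x = joint_cdf G (\<lambda>j. ereal (a n j) * x j + ereal (b n j)) ^ n"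
  by (simp_all add: normalised_maximum_law F.vector_distribution_axioms G.vector_distribution_axioms a)

lemma P_tendsto_real: "(\<lambda>n. joint_cdf (P n) (\<lambda>j. ereal (y j))) \<longlonglongrightarrow> joint_cdf H (\<lambda>j. ereal (y j))"
proof (rule Lim_transform_eventually[OF attraction])
  show "\<forall>\<^sub>F n in sequentially.
      joint_cdf F (\<lambda>j. ereal (a n j * y j + b n j)) ^ n = joint_cdf (P n) (\<lambda>j. ereal (y j))"
    using eventually_gt_at_top[of 0] by eventually_elim (simp add: joint_cdf_P)
qed

lemma cont_H: "isCont (cdf (margin H j)) r"
  using extreme_margins[of j] isCont_gumbel isCont_weibull[OF \<alpha>] isCont_frechet[OF \<alpha>] by auto

lemmas P_tendsto = joint_cdf_tendsto_extended[OF P H.vector_distribution_axioms P_tendsto_real]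
lemmas P_tendsto_moving = joint_cdf_tendsto_moving[OF P H.vector_distribution_axioms P_tendsto_real cont_H]

lemma P_margin_tendsto:
  "(\<lambda>n. joint_margin F j (ereal (a n j * r + b n j)) ^ n) \<longlonglongrightarrow> cdf (margin H j) r"
proof -
  have "(\<lambda>n. joint_margin (P n) j (ereal r)) \<longlonglongrightarrow> joint_margin H j (ereal r)"
    unfolding joint_margin_def by (intro P_tendsto) auto
  moreover have "\<forall>\<^sub>F n in sequentially. joint_margin (P n) j (ereal r) =
      joint_margin F j (ereal (a n j * r + b n j)) ^ n"
    using eventually_gt_at_top[of 0]
    by eventually_elim (simp add: normalised_maximum_margin F.vector_distribution_axioms a)
  ultimately show ?thesis by (auto simp: H.cdf_margin intro: Lim_transform_eventually)
qed

lemma light_margin_pos: "\<not> heavy j \<Longrightarrow> 0 < cdf (margin H j) r"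
  using extreme_margins[of j] by (auto simp: heavy_def gumbel_def weibull_def)

lemma heavy_margin_pos_iff: "heavy j \<Longrightarrow> 0 < cdf (margin H j) r \<longleftrightarrow> 0 < r"
  by (auto simp: heavy_def frechet_def)

text \<open>
  The factor \<open>G\<close> in the functional equation is at most 1, so \<open>F_j x \<le> F_j (x / c j)\<close>.
\<close>

lemma F_margin_vanishes:
  assumes "r < 0"
  shows "joint_margin F j (ereal r) = 0"
proof (rule scaled_cdf_vanishes_on_negatives[where F = "\<lambda>r. joint_margin F j (ereal r)", OF _ _ c])
  fix x :: real
  have "joint_margin F j (ereal x) =
      joint_cdf F (\<lambda>i. ereal (1 / c i) * ((\<lambda>_. \<infinity>)(j := ereal x)) i) * joint_cdf G ((\<lambda>_. \<infinity>)(j := ereal x))"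
    unfolding joint_margin_def by (rule recursion)
  also have "(\<lambda>i. ereal (1 / c i) * ((\<lambda>_. \<infinity>)(j := ereal x)) i) = (\<lambda>_. \<infinity>)(j := ereal (x / c j))"
    using c by (auto simp: fun_eq_iff) (metis less_irrefl)
  also have "joint_cdf F ((\<lambda>_. \<infinity>)(j := ereal (x / c j))) * joint_cdf G ((\<lambda>_. \<infinity>)(j := ereal x))
      \<le> joint_margin F j (ereal (x / c j)) * 1"
    unfolding joint_margin_def by (intro mult_left_mono G.joint_cdf_le_1 F.joint_cdf_nonneg)
  finally show "joint_margin F j (ereal x) \<le> joint_margin F j (ereal (x / c j))" by simp
qed (use assms F.joint_margin_nonneg F.joint_margin_at_bot in auto)

lemma light_location: "\<not> heavy j \<Longrightarrow> filterlim (\<lambda>n. b n j / a n j) at_top sequentially"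
  by (rule location_dominates_scale[OF F_margin_vanishes a P_margin_tendsto light_margin_pos])

lemma heavy_location:
  assumes "heavy j"
  shows "(\<lambda>n. b n j / a n j) \<longlonglongrightarrow> 0"
proof (rule frechet_location_negligible[where F = "\<lambda>r. joint_margin F j (ereal r)"])
  show "(\<lambda>n. joint_margin F j (ereal (a n j * x + b n j)) ^ n) \<longlonglongrightarrow> frechet (\<alpha> j) x" for x
    using P_margin_tendsto[of j x] assms by (simp add: heavy_def)
qed (auto intro!: monoI F.joint_margin_mono F.joint_margin_nonneg a \<alpha>)

definition shrunk_argument :: "nat \<Rightarrow> ('d \<Rightarrow> ereal) \<Rightarrow> 'd \<Rightarrow> ereal" where
  "shrunk_argument n x j = ereal (1 / c j) * x j + ereal ((1 / c j - 1) * (b n j / a n j))"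

lemma P_eq_P_Q:
  assumes "n > 0"
  shows "joint_cdf (P n) x = joint_cdf (P n) (shrunk_argument n x) * joint_cdf (Q n) x"
proof -
  have "ereal (1 / c j) * (ereal (a n j) * x j + ereal (b n j)) =
      ereal (a n j) * shrunk_argument n x j + ereal (b n j)" for j
    using c[of j] a[of n j] by (cases "x j") (auto simp: shrunk_argument_def field_simps)
  then show ?thesis
    using assms recursion[of "\<lambda>j. ereal (a n j) * x j + ereal (b n j)"]
    by (simp add: joint_cdf_P joint_cdf_Q power_mult_distrib)
qed

lemma shrunk_argument_tendsto:
  assumes "x j \<noteq> -\<infinity>"
  shows "(\<lambda>n. shrunk_argument n x j) \<longlonglongrightarrow> dilate x j"
proof (cases "x j")
  case PInf
  then show ?thesis using c[of j] by (simp add: shrunk_argument_def dilate_def)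
next
  case (real r)
  have eq: "shrunk_argument n x j = ereal (r / c j + (1 / c j - 1) * (b n j / a n j))" for n
    using real by (simp add: shrunk_argument_def)
  show ?thesis
  proof (cases "heavy j")
    case True
    have "(\<lambda>n. ereal (r / c j + (1 / c j - 1) * (b n j / a n j))) \<longlonglongrightarrow> ereal (r / c j + (1 / c j - 1) * 0)"
      by (intro tendsto_intros heavy_location True)
    then show ?thesis using True real by (simp add: eq dilate_def)
  next
    case False
    have "0 < 1 / c j - 1" using c[of j] by simp
    then have "filterlim (\<lambda>n. r / c j + (1 / c j - 1) * (b n j / a n j)) at_top sequentially"
      by (intro filterlim_tendsto_add_at_top[OF tendsto_const]
          filterlim_tendsto_pos_mult_at_top[OF tendsto_const] light_location False)
    then have "(\<lambda>n. ereal (r / c j + (1 / c j - 1) * (b n j / a n j))) \<longlonglongrightarrow> \<infinity>"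
      by (simp add: tendsto_PInfty filterlim_at_top_dense)
    then show ?thesis using False by (simp add: eq dilate_def)
  qed
qed (use assms in auto)

lemma dilate_not_MInfty: "x j \<noteq> -\<infinity> \<Longrightarrow> dilate x j \<noteq> -\<infinity>"
  using c[of j] by (cases "x j") (auto simp: dilate_def)

lemma P_shrunk_tendsto:
  assumes "\<And>j. x j \<noteq> -\<infinity>"
  shows "(\<lambda>n. joint_cdf (P n) (shrunk_argument n x)) \<longlonglongrightarrow> joint_cdf H (dilate x)"
  by (intro P_tendsto_moving dilate_not_MInfty shrunk_argument_tendsto assms)

lemma le_dilate:
  assumes "0 < joint_margin H j (x j)" "x j \<noteq> -\<infinity>"
  shows "x j \<le> dilate x j"
proof (cases "x j")
  case (real r)
  have "r \<le> r / c j" if "heavy j"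
  proof -
    have "0 < r" using assms(1) that real heavy_margin_pos_iff[OF that, of r] by (simp add: H.cdf_margin)
    then show ?thesis using c[of j] by (simp add: field_simps)
  qed
  with real show ?thesis by (auto simp: dilate_def)
qed (use assms c[of j] in \<open>auto simp: dilate_def\<close>)

text \<open>
  The union bound \<open>1 - f n \<le> (\<Sum>j. 1 - q n j)\<close> controls \<open>n * (1 - f n)\<close> by the margins, and a bound
  on \<open>n * (1 - f n)\<close> keeps \<open>f n ^ n\<close> away from 0. This makes the denominator \<open>H (dilate x)\<close> positive.
\<close>

lemma H_positive:
  assumes x: "\<And>j. x j \<noteq> -\<infinity>" and pos: "\<And>j. 0 < joint_margin H j (x j)"
  shows "0 < joint_cdf H x"
proof -
  define f where "f n = joint_cdf F (\<lambda>j. ereal (a n j) * x j + ereal (b n j))" for n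
  define q where "q n j = joint_margin F j (ereal (a n j) * x j + ereal (b n j))" for n j
  have "\<forall>\<^sub>F n in sequentially. joint_cdf (P n) x = f n ^ n"
    using eventually_gt_at_top[of 0] by eventually_elim (simp add: joint_cdf_P f_def)
  then have lim: "(\<lambda>n. f n ^ n) \<longlonglongrightarrow> joint_cdf H x"
    by (rule Lim_transform_eventually[OF P_tendsto[OF x]])
  have "\<forall>\<^sub>F n in sequentially. real n * (1 - q n j) \<le> 1 - ln (joint_margin H j (x j))" for j
  proof -
    have limq: "(\<lambda>n. joint_margin (P n) j (x j)) \<longlonglongrightarrow> joint_margin H j (x j)"
      unfolding joint_margin_def using x by (intro P_tendsto) auto
    have "(\<lambda>n. - ln (joint_margin (P n) j (x j))) \<longlonglongrightarrow> - ln (joint_margin H j (x j))"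
      using pos[of j] by (intro tendsto_intros limq) auto
    then have "\<forall>\<^sub>F n in sequentially. - ln (joint_margin (P n) j (x j)) < 1 - ln (joint_margin H j (x j))"
      by (rule order_tendstoD) simp
    with order_tendstoD(1)[OF limq pos] eventually_gt_at_top[of 0] show ?thesis
    proof eventually_elim
      case (elim n)
      have eq: "joint_margin (P n) j (x j) = q n j ^ n"
        using elim by (simp add: normalised_maximum_margin F.vector_distribution_axioms a q_def)
      have "0 \<le> q n j" by (simp add: q_def F.joint_margin_nonneg)
      with elim eq have "0 < q n j" by (cases "q n j = 0") (auto simp: power_0_left)
      then have "1 - q n j \<le> - ln (q n j)" using ln_le_minus_one[of "q n j"] by simp
      then have "real n * (1 - q n j) \<le> real n * (- ln (q n j))" by (intro mult_left_mono) auto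
      also have "\<dots> = - ln (joint_margin (P n) j (x j))"
        using \<open>0 < q n j\<close> by (simp add: eq ln_realpow)
      finally show ?case using elim by simp
    qed
  qed
  then have "\<forall>\<^sub>F n in sequentially. \<forall>j. real n * (1 - q n j) \<le> 1 - ln (joint_margin H j (x j))"
    by (simp add: eventually_all_finite)
  then have "\<forall>\<^sub>F n in sequentially. real n * (1 - f n) \<le> (\<Sum>j\<in>UNIV. 1 - ln (joint_margin H j (x j)))"
  proof eventually_elim
    case (elim n)
    have "real n * (1 - f n) \<le> real n * (\<Sum>j\<in>UNIV. 1 - q n j)"
      unfolding f_def q_def by (intro mult_left_mono F.joint_cdf_union_bound) auto
    also have "\<dots> \<le> (\<Sum>j\<in>UNIV. 1 - ln (joint_margin H j (x j)))"
      unfolding sum_distrib_left using elim by (intro sum_mono) auto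
    finally show ?case .
  qed
  from power_lower_bound_limit[OF lim this] show ?thesis
    by (meson exp_gt_zero less_le_trans)
qed

lemma H_dilate_positive:
  assumes "\<And>j. x j \<noteq> -\<infinity>" "\<And>j. 0 < joint_margin H j (x j)"
  shows "0 < joint_cdf H (dilate x)"
  using H_positive[OF assms] H.joint_cdf_mono[of x "dilate x"] le_dilate assms
  by (meson less_le_trans)

lemma margin_power: "0 < margin_power j" "margin_power j \<le> 1"
proof -
  have "c j powr \<alpha> j < 1 powr \<alpha> j"
    using c[of j] \<alpha>[of j] by (intro powr_less_mono2) auto
  then show "0 < margin_power j" "margin_power j \<le> 1" by (auto simp: margin_power_def)
qed

text \<open>
  In the Frechet case, dividing the argument by \<open>c\<close> amounts to raising the distribution function to the
  power \<open>c powr \<alpha> = 1 - \<theta>\<close>, where \<open>\<theta> = margin_power j\<close>; in the other cases both sides are 1.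
\<close>

lemma margin_dilate:
  assumes "0 < joint_margin H j (x j)" "x j \<noteq> -\<infinity>"
  shows "joint_margin H j (dilate x j) = joint_margin H j (x j) powr (1 - margin_power j)"
proof (cases "heavy j")
  case True
  show ?thesis
  proof (cases "x j")
    case (real r)
    have "joint_margin H j (dilate x j) = frechet (\<alpha> j) (1 / c j * r)"
      using True real H.cdf_margin[of j, symmetric] by (simp add: dilate_def heavy_def fun_eq_iff)
    also have "\<dots> = frechet (\<alpha> j) r powr ((1 / c j) powr - \<alpha> j)"
      using c[of j] by (intro frechet_scale) simp
    also have "(1 / c j) powr - \<alpha> j = c j powr \<alpha> j"
      using c[of j] by (simp add: powr_divide powr_minus)
    also have "frechet (\<alpha> j) r = joint_margin H j (x j)"
      using True real H.cdf_margin[of j, symmetric] by (simp add: heavy_def fun_eq_iff)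
    finally show ?thesis using True by (simp add: margin_power_def)
  next
    case PInf
    then show ?thesis using True c[of j] by (simp add: dilate_def)
  qed (use assms in auto)
qed (use assms in \<open>simp add: dilate_def margin_power_def\<close>)

lemma limit_cdf_margin:
  assumes "r \<noteq> -\<infinity>"
  shows "limit_cdf ((\<lambda>_. \<infinity>)(j := r)) = joint_margin H j r powr margin_power j"
proof (cases "0 < joint_margin H j r")
  case True
  let ?x = "(\<lambda>_. \<infinity>)(j := r)"
  have "dilate ?x = (\<lambda>_. \<infinity>)(j := dilate ?x j)"
    using c by (auto simp: fun_eq_iff dilate_def) (metis less_irrefl)
  then have "joint_cdf H (dilate ?x) = joint_margin H j (dilate ?x j)"
    unfolding joint_margin_def by simp
  also have "\<dots> = joint_margin H j r powr (1 - margin_power j)"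
    using margin_dilate[of j ?x] True assms by simp
  finally have "joint_cdf H (dilate ?x) = joint_margin H j r powr (1 - margin_power j)" .
  moreover have "joint_margin H j r = joint_margin H j r powr 1" using True by simp
  then have "joint_cdf H ?x / joint_margin H j r powr (1 - margin_power j) = joint_margin H j r powr (1 - (1 - margin_power j))"
    unfolding joint_margin_def[symmetric] powr_diff by simp
  ultimately show ?thesis using True by (simp add: limit_cdf_def)
next
  case False
  then have "joint_margin H j r = 0" using H.joint_margin_nonneg[of j r] by linarith
  moreover from False have "\<not> (\<forall>i. 0 < joint_margin H i (((\<lambda>_. \<infinity>)(j := r)) i))"
    by (auto intro!: exI[of _ j])
  ultimately show ?thesis by (simp add: limit_cdf_def)
qed

lemma Q_tendsto_positive:
  assumes x: "\<And>j. x j \<noteq> -\<infinity>" and pos: "\<And>j. 0 < joint_margin H j (x j)"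
  shows "(\<lambda>n. joint_cdf (Q n) x) \<longlonglongrightarrow> limit_cdf x"
proof -
  note L = H_dilate_positive[OF assms]
  have "(\<lambda>n. joint_cdf (P n) x / joint_cdf (P n) (shrunk_argument n x)) \<longlonglongrightarrow> joint_cdf H x / joint_cdf H (dilate x)"
    using L by (intro tendsto_divide P_tendsto P_shrunk_tendsto x) auto
  moreover have "\<forall>\<^sub>F n in sequentially.
      joint_cdf (P n) x / joint_cdf (P n) (shrunk_argument n x) = joint_cdf (Q n) x"
    using order_tendstoD(1)[OF P_shrunk_tendsto[OF x] L] eventually_gt_at_top[of 0]
    by eventually_elim (use P_eq_P_Q[of _ x] in simp)
  ultimately show ?thesis
    using pos by (auto simp: limit_cdf_def intro: Lim_transform_eventually)
qed

text \<open>
  Where a margin of \<open>H\<close> vanishes, the functional equation says nothing in the limit. There the coordinate is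
  nonpositive and of Frechet type, and monotonicity bounds \<open>Q n\<close> by its margin at a small positive \<open>s\<close>.
\<close>

lemma Q_tendsto:
  assumes x: "\<And>j. x j \<noteq> -\<infinity>"
  shows "(\<lambda>n. joint_cdf (Q n) x) \<longlonglongrightarrow> limit_cdf x"
proof (cases "\<forall>j. 0 < joint_margin H j (x j)")
  case True
  then show ?thesis using x by (intro Q_tendsto_positive) auto
next
  case False
  then obtain j where j: "\<not> 0 < joint_margin H j (x j)" by blast
  obtain r where r: "x j = ereal r" using j x[of j] by (cases "x j") auto
  have hv: "heavy j" using j light_margin_pos[of j r] by (auto simp: r H.cdf_margin)
  then have "r \<le> 0" using j heavy_margin_pos_iff[of j r] by (simp add: r H.cdf_margin)
  have "(\<lambda>n. joint_cdf (Q n) x) \<longlonglongrightarrow> 0"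
  proof (rule order_tendstoI)
    fix e :: real assume "0 < e"
    have "((\<lambda>s. cdf (margin H j) s powr margin_power j) \<longlongrightarrow> cdf (margin H j) 0 powr margin_power j) (at 0)"
      using cont_H[where j = j and r = 0] margin_power[of j] H.joint_margin_nonneg
      by (intro tendsto_powr') (auto simp: isCont_def H.cdf_margin)
    moreover have "cdf (margin H j) 0 = 0"
      using hv by (simp add: heavy_def frechet_def)
    ultimately have "((\<lambda>s. cdf (margin H j) s powr margin_power j) \<longlongrightarrow> 0) (at_right 0)"
      by (simp add: filterlim_at_split)
    then have "\<forall>\<^sub>F s in at_right 0. cdf (margin H j) s powr margin_power j < e \<and> 0 < s"
      using \<open>0 < e\<close> by (intro eventually_conj order_tendstoD(2)[of _ 0]) (auto simp: eventually_at_filter)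
    then have "\<exists>s. cdf (margin H j) s powr margin_power j < e \<and> 0 < s" by (rule eventually_happens'[rotated]) simp
    then obtain s where s: "cdf (margin H j) s powr margin_power j < e" "0 < s" by blast
    let ?z = "(\<lambda>_. \<infinity>)(j := ereal s)"
    have "0 < joint_margin H i (?z i)" for i
      using heavy_margin_pos_iff[OF hv, of s] s by (simp add: H.cdf_margin)
    then have "(\<lambda>n. joint_cdf (Q n) ?z) \<longlonglongrightarrow> limit_cdf ?z"
      by (intro Q_tendsto_positive) auto
    then have "\<forall>\<^sub>F n in sequentially. joint_cdf (Q n) ?z < e"
      using s by (intro order_tendstoD(2)) (auto simp: limit_cdf_margin H.cdf_margin)
    then show "\<forall>\<^sub>F n in sequentially. joint_cdf (Q n) x < e"
    proof eventually_elim
      case (elim n)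
      have "joint_cdf (Q n) x \<le> joint_cdf (Q n) ?z"
        using r \<open>r \<le> 0\<close> s by (intro vector_distribution.joint_cdf_mono[OF Q]) auto
      with elim show ?case by simp
    qed
  next
    fix e :: real assume "e < 0"
    then show "\<forall>\<^sub>F n in sequentially. e < joint_cdf (Q n) x"
      by (intro always_eventually allI less_le_trans[OF _ vector_distribution.joint_cdf_nonneg[OF Q]])
  qed
  then show ?thesis using False by (auto simp: limit_cdf_def)
qed

lemma innovation_limit_exists:
  "\<exists>V. vector_distribution V \<and> (\<forall>x. (\<forall>j. x j \<noteq> -\<infinity>) \<longrightarrow> joint_cdf V x = limit_cdf x)"
proof (rule limit_of_vector_distributions[OF Q Q_tendsto])
  have eq: "(\<lambda>r. limit_cdf ((\<lambda>_. \<infinity>)(j := ereal r))) = (\<lambda>r. cdf (margin H j) r powr margin_power j)" for j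
    by (simp add: limit_cdf_margin H.cdf_margin)
  have nn: "\<forall>\<^sub>F r in A. 0 \<le> cdf (margin H j) r" for A j
    by (simp add: H.cdf_margin H.joint_margin_nonneg)
  show "isCont (\<lambda>r. limit_cdf ((\<lambda>_. \<infinity>)(j := ereal r))) r" for j r
    unfolding eq isCont_def
    using cont_H[where j = j and r = r] margin_power[of j] nn by (intro tendsto_powr') (auto simp: isCont_def)
  have "((\<lambda>r. cdf (margin H j) r powr margin_power j) \<longlongrightarrow> 0 powr margin_power j) at_bot" for j
    using H.joint_margin_at_bot margin_power[of j] nn by (intro tendsto_powr') (auto simp: H.cdf_margin)
  then show "((\<lambda>r. limit_cdf ((\<lambda>_. \<infinity>)(j := ereal r))) \<longlongrightarrow> 0) at_bot" for j
    unfolding eq by simp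
  have "((\<lambda>r. cdf (margin H j) r powr margin_power j) \<longlongrightarrow> 1 powr margin_power j) at_top" for j
    using H.joint_margin_at_top by (intro tendsto_powr tendsto_const) (auto simp: H.cdf_margin)
  then show "((\<lambda>r. limit_cdf ((\<lambda>_. \<infinity>)(j := ereal r))) \<longlongrightarrow> 1) at_top" for j
    unfolding eq by simp
qed

theorem innovation_attraction:
  "\<exists>V. vector_distribution V \<and> max_domain_of_attraction G V \<and>
     (\<forall>j x. cdf (margin V j) x = cdf (margin H j) x powr margin_power j) \<and>
     (\<forall>u. (\<forall>j. 0 < u j \<and> u j \<le> 1) \<longrightarrow>
       copula V u = copula H (\<lambda>j. u j powr (1 / margin_power j)) / copula H (\<lambda>j. u j powr (1 / margin_power j - 1)))"
proof -
  from innovation_limit_exists obtain V where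
    V': "vector_distribution V \<and> (\<forall>x. (\<forall>j. x j \<noteq> -\<infinity>) \<longrightarrow> joint_cdf V x = limit_cdf x)" ..
  then have "vector_distribution V" ..
  have V: "joint_cdf V x = limit_cdf x" if "\<And>j. x j \<noteq> -\<infinity>" for x
    using V' that by simp
  interpret V: vector_distribution V by fact
  have margin_V: "joint_margin V j r = joint_margin H j r powr margin_power j" if "r \<noteq> -\<infinity>" for j r
    unfolding joint_margin_def[of V] using that by (simp add: V limit_cdf_margin)
  have attr: "max_domain_of_attraction G V"
    unfolding max_domain_of_attraction_def
  proof (intro exI conjI allI)
    show "0 < a n j" for n j by (rule a)
    fix x :: "'d \<Rightarrow> real"
    have "(\<lambda>n. joint_cdf (Q n) (\<lambda>j. ereal (x j))) \<longlonglongrightarrow> joint_cdf V (\<lambda>j. ereal (x j))"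
      using Q_tendsto[of "\<lambda>j. ereal (x j)"] by (simp add: V)
    moreover have "\<forall>\<^sub>F n in sequentially. joint_cdf (Q n) (\<lambda>j. ereal (x j)) =
        joint_cdf G (\<lambda>j. ereal (a n j * x j + b n j)) ^ n"
      using eventually_gt_at_top[of 0] by eventually_elim (simp add: joint_cdf_Q)
    ultimately show "(\<lambda>n. joint_cdf G (\<lambda>j. ereal (a n j * x j + b n j)) ^ n)
        \<longlonglongrightarrow> joint_cdf V (\<lambda>j. ereal (x j))"
      by (rule Lim_transform_eventually)
  qed
  have cdf_V: "cdf (margin V j) = (\<lambda>x. cdf (margin H j) x powr margin_power j)" for j
    by (simp add: V.cdf_margin H.cdf_margin margin_V)
  have cont_V: "isCont (cdf (margin V j)) x" for j x
    unfolding cdf_V isCont_def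
    using cont_H[where j = j and r = x] margin_power[of j]
    by (intro tendsto_powr') (auto simp: isCont_def H.cdf_margin H.joint_margin_nonneg)
  have copula_V: "copula V u = copula H (\<lambda>j. u j powr (1 / margin_power j)) / copula H (\<lambda>j. u j powr (1 / margin_power j - 1))"
    if u: "\<forall>j. 0 < u j \<and> u j \<le> 1" for u
  proof -
    define q where "q j = quantile (margin V j) (u j)" for j
    have q: "q j \<noteq> -\<infinity>" "joint_margin V j (q j) = u j" for j
      unfolding q_def using u by (intro V.joint_margin_quantile cont_V; simp)+
    have Hq: "joint_margin H j (q j) = u j powr (1 / margin_power j)" for j
    proof -
      have "u j = joint_margin H j (q j) powr margin_power j" using q margin_V by metis
      then show ?thesis using margin_power[of j] H.joint_margin_nonneg[of j "q j"] by (simp add: powr_powr)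
    qed
    have pos: "0 < joint_margin H j (q j)" for j using Hq[of j] u[rule_format, of j] by simp
    have Hdq: "joint_margin H j (dilate q j) = u j powr (1 / margin_power j - 1)" for j
    proof -
      have "1 / margin_power j * (1 - margin_power j) = 1 / margin_power j - 1"
        using margin_power[of j] by (simp add: field_simps)
      then show ?thesis
        using margin_dilate[of j q, OF pos q(1)] by (simp add: Hq powr_powr)
    qed
    have "copula V u = joint_cdf H q / joint_cdf H (dilate q)"
      unfolding copula_def q_def[symmetric] using q(1) pos by (simp add: V limit_cdf_def)
    also have "joint_cdf H q = copula H (\<lambda>j. u j powr (1 / margin_power j))"
      using H.joint_cdf_eq_copula[OF cont_H, of q] pos by (simp add: Hq)
    also have "joint_cdf H (dilate q) = copula H (\<lambda>j. u j powr (1 / margin_power j - 1))"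
    proof -
      have "0 < joint_margin H j (dilate q j)" for j
        using Hdq[of j] u[rule_format, of j] by simp
      from H.joint_cdf_eq_copula[OF cont_H this] show ?thesis by (simp add: Hdq)
    qed
    finally show ?thesis .
  qed
  show ?thesis
    by (intro exI[of _ V] conjI allI impI V.vector_distribution_axioms attr copula_V)
      (simp_all add: cdf_V)
qed

end

text \<open>
  The event that \<open>X 1\<close> lies below \<open>x\<close> is the intersection of the independent events that \<open>X 0\<close> lies
  below \<open>x / c\<close> and \<open>Y 1\<close> below \<open>x\<close>.
\<close>

lemma max_recursion_joint_cdf:
  fixes M :: "'a measure" and X Y :: "nat \<Rightarrow> 'a \<Rightarrow> real ^ 'd" and c :: "'d \<Rightarrow> real"
  assumes M: "prob_space M" and c: "\<And>j. 0 < c j"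
    and indep: "prob_space.indep_vars M (\<lambda>_. borel) (\<lambda>n. if n = 0 then X 0 else Y n) UNIV"
    and G: "distr M borel (Y 1) = G"
    and rec: "\<And>j \<omega>. \<omega> \<in> space M \<Longrightarrow> X 1 \<omega> $ j = max (c j * X 0 \<omega> $ j) (Y 1 \<omega> $ j)"
    and F: "distr M borel (X 0) = F" "distr M borel (X 1) = F"
  shows "vector_distribution F" and "vector_distribution G"
    and "joint_cdf F x = joint_cdf F (\<lambda>j. ereal (1 / c j) * x j) * joint_cdf G x"
proof -
  interpret prob_space M by fact
  have rv: "(if n = 0 then X 0 else Y n) \<in> borel_measurable M" for n
    using indep by (auto simp: indep_vars_def)
  have X0 [measurable]: "X 0 \<in> borel_measurable M" using rv[of 0] by simp
  have Y1 [measurable]: "Y 1 \<in> borel_measurable M" using rv[of 1] by simp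
  have "(\<lambda>\<omega>. \<chi> j. max (c j * X 0 \<omega> $ j) (Y 1 \<omega> $ j)) \<in> borel_measurable M"
    by (rule borel_measurable_vec_lambda) measurable
  then have X1 [measurable]: "X 1 \<in> borel_measurable M"
    by (rule measurable_cong[THEN iffD1, rotated]) (simp add: rec[unfolded One_nat_def] vec_eq_iff)
  have vd: "vector_distribution (distr M borel Z)" if "Z \<in> borel_measurable M" for Z :: "'a \<Rightarrow> real ^ 'd"
    by (intro vector_distribution.intro prob_space_distr that vector_distribution_axioms.intro) simp
  from vd[OF X0] vd[OF Y1] show "vector_distribution F" "vector_distribution G"
    unfolding F G .
  let ?S = "\<lambda>x. {y :: real ^ 'd. \<forall>j. ereal (y $ j) \<le> x j}"
  let ?x' = "\<lambda>j. ereal (1 / c j) * x j"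
  have law: "joint_cdf (distr M borel Z) z = prob (Z -` ?S z \<inter> space M)"
    if "Z \<in> borel_measurable M" for Z z
    unfolding joint_cdf_def using that by (subst measure_distr) auto
  have scale: "ereal (c j * s) \<le> t \<longleftrightarrow> ereal s \<le> ereal (1 / c j) * t" for s t j
    using c[of j] by (cases t) (auto simp: field_simps)
  have "joint_cdf F x = prob (X 1 -` ?S x \<inter> space M)"
    using law[OF X1] F by simp
  also have "X 1 -` ?S x \<inter> space M =
      (\<Inter>n\<in>{0, 1}. (if n = 0 then X 0 else Y n) -` (if n = 0 then ?S ?x' else ?S x) \<inter> space M)"
    by (auto simp: rec[unfolded One_nat_def] ereal_max_le_iff scale)
  also have "prob \<dots> = (\<Prod>n\<in>{0, 1}. prob ((if n = 0 then X 0 else Y n) -` (if n = 0 then ?S ?x' else ?S x) \<inter> space M))"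
    by (intro indep_varsD[OF indep]) auto
  also have "\<dots> = joint_cdf F ?x' * joint_cdf G x"
    using law[OF X0] law[OF Y1] F G by simp
  finally show "joint_cdf F x = joint_cdf F ?x' * joint_cdf G x" .
qed

theorem proposition4p2:
  fixes M :: "'a measure"
    and X Y :: "nat \<Rightarrow> 'a \<Rightarrow> real ^ 'd"
    and F G H :: "(real ^ 'd) measure"
    and c \<alpha> \<theta> :: "'d \<Rightarrow> real"
  assumes "prob_space M"
    and "\<And>j. 0 < c j \<and> c j < 1"
    and "prob_space.indep_vars M (\<lambda>_. borel) (\<lambda>n. if n = 0 then X 0 else Y n) UNIV"
    and "\<And>n. n \<ge> 1 \<Longrightarrow> distr M borel (Y n) = G"
    and "\<And>n j \<omega>. n \<ge> 1 \<Longrightarrow> \<omega> \<in> space M \<Longrightarrow>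
           X n \<omega> $ j = max (c j * X (n - 1) \<omega> $ j) (Y n \<omega> $ j)"
    and "stationary M X"
    and "\<And>n. distr M borel (X n) = F"
    and "prob_space H" and "sets H = sets borel"
    and "max_domain_of_attraction F H"
    and "\<And>j. \<alpha> j > 0"
    and "\<And>j. cdf (margin H j) \<in> {gumbel, weibull (\<alpha> j), frechet (\<alpha> j)}"
    and "\<And>j. \<theta> j = (if cdf (margin H j) \<in> {gumbel, weibull (\<alpha> j)} then 1
                      else 1 - c j powr \<alpha> j)"
  shows "\<exists>V :: (real ^ 'd) measure.
           prob_space V \<and> sets V = sets borel \<and>
           max_domain_of_attraction G V \<and>
           (\<forall>j x. cdf (margin V j) x = cdf (margin H j) x powr \<theta> j) \<and>
           (\<forall>u :: 'd \<Rightarrow> real. (\<forall>j. 0 < u j \<and> u j \<le> 1) \<longrightarrow>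
              copula V u = copula H (\<lambda>j. u j powr (1 / \<theta> j)) /
                           copula H (\<lambda>j. u j powr (1 / \<theta> j - 1)))"
proof -
  have rec1: "X 1 \<omega> $ j = max (c j * X 0 \<omega> $ j) (Y 1 \<omega> $ j)" if "\<omega> \<in> space M" for j \<omega>
    using assms(5)[of 1 \<omega> j] that by simp
  have c: "0 < c j" "c j < 1" for j using assms(2) by auto
  note FG = max_recursion_joint_cdf[OF assms(1) c(1) assms(3) assms(4)[OF order_refl] rec1 assms(7) assms(7)]
  obtain a b :: "nat \<Rightarrow> 'd \<Rightarrow> real" where a: "\<And>n j. a n j > 0"
    and conv: "\<And>x. (\<lambda>n. joint_cdf F (\<lambda>j. ereal (a n j * x j + b n j)) ^ n) \<longlonglongrightarrow> joint_cdf H (\<lambda>j. ereal (x j))"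
    using assms(10) unfolding max_domain_of_attraction_def by blast
  have H: "vector_distribution H"
    using assms(8,9) by (intro vector_distribution.intro vector_distribution_axioms.intro)
  interpret attracted_max_autoregression F G H c \<alpha> a b
    by (intro attracted_max_autoregression.intro attracted_max_autoregression_axioms.intro FG H c a conv assms(11,12))
  have "frechet (\<alpha> j) \<notin> {gumbel, weibull (\<alpha> j)}" for j
  proof -
    have "frechet (\<alpha> j) 0 \<noteq> gumbel 0" "frechet (\<alpha> j) 0 \<noteq> weibull (\<alpha> j) 0"
      by (simp_all add: gumbel_def weibull_def frechet_def)
    then show ?thesis by auto
  qed
  then have "heavy j \<longleftrightarrow> cdf (margin H j) \<notin> {gumbel, weibull (\<alpha> j)}" for j
    using assms(12)[of j] unfolding heavy_def by (metis insert_iff)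
  then have "margin_power = \<theta>"
    unfolding fun_eq_iff margin_power_def assms(13) by simp
  with innovation_attraction obtain V where "vector_distribution V"
    and V: "max_domain_of_attraction G V" "\<forall>j x. cdf (margin V j) x = cdf (margin H j) x powr \<theta> j"
      "\<forall>u. (\<forall>j. 0 < u j \<and> u j \<le> 1) \<longrightarrow>
         copula V u = copula H (\<lambda>j. u j powr (1 / \<theta> j)) / copula H (\<lambda>j. u j powr (1 / \<theta> j - 1))"
    by blast
  moreover have "prob_space V" "sets V = sets borel"
    using \<open>vector_distribution V\<close> by (simp_all add: vector_distribution_def vector_distribution_axioms_def)
  ultimately show ?thesis by blast
qed

end
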